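(* Fix $n\in\mathbb{N}$ and complex parameters $a_1,\dots,a_n,b_1,\dots,b_n$ of modulus strictly less than $1$. The family of symmetric polynomials $\{\mathbb{F}_\lambda(x_1,\dots,x_n|a_1,\dots,a_n;b_1,\dots,b_n)\}_{\lambda\in\mathbb{Y}_n}$ is a linear basis of the space $\mathsf{Sym}_n$ of symmetric polynomials in $n$ variables $x_1,\dots,x_n$ (over $\mathbb{C}$).
   Context: Let $q\in\mathbb{C}$ with $|q|<1$, and $(z;q)_k=\prod_{i=0}^{k-1}(1-zq^i)$ for $k\in\mathbb{Z}_{\ge0}$. $\mathbb{Y}_n$ is the set of integer partitions $\lambda=(\lambda_1\ge\dots\ge\lambda_n\ge0)$ with at most $n$ nonzero parts, with $\lambda_i=0$ for $i>n$; $|\lambda|=\sum_i\lambda_i$. For partitions, $\mu\preceq\lambda$ means $\lambda_i\ge\mu_i\ge\lambda_{i+1}$ for all $i\ge1$. Spin $q$-Whittaker polynomials (Borodin-Korotkikh version): let $c_1,\dots,c_n,d_1,\dots,d_n$ be complex parameters of modulus $<1$. For $\lambda\in\mathbb{Y}_n$, $\mu\in\mathbb{Y}_{n-1}$ set $$\mathbb{F}_{\lambda/\mu}(x|c_1,\dots,c_n;d_1,\dots,d_n)=\mathbf 1_{\mu\preceq\lambda}\,x^{|\lambda|-|\mu|}\prod_{r=1}^n\frac{(c_r/x;q)_{\lambda_r-\mu_r}(xd_r;q)_{\mu_r-\lambda_{r+1}}(q;q)_{\lambda_r-\lambda_{r+1}}}{(q;q)_{\lambda_r-\mu_r}(q;q)_{\mu_r-\lambda_{r+1}}(c_rd_r;q)_{\lambda_r-\lambda_{r+1}}}.$$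 Define recursively, starting from $\mathbb{F}_\varnothing=1$ in zero variables, $$\mathbb{F}_\lambda(x_1,\dots,x_n|c_1,\dots,c_n;d_1,\dots,d_n)=\sum_{\mu\in\mathbb{Y}_{n-1},\,\mu\preceq\lambda}\mathbb{F}_\mu(x_1,\dots,x_{n-1}|c_2,\dots,c_n;d_1,\dots,d_{n-1})\,\mathbb{F}_{\lambda/\mu}(x_n|c_1,\dots,c_n;d_1,\dots,d_n).$$ These are polynomials, known to be symmetric in $x_1,\dots,x_n$. *)

theory Defs
  imports Complex_Main
    "HOL-Library.Poly_Mapping"
    "HOL-Computational_Algebra.Polynomial"
    "HOL-Combinatorics.Permutations"
begin

section \<open>Multivariate polynomials over the complex numbers\<close>

text \<open>
  A polynomial is a finitely supported map from monomials to coefficients, and a monomial is a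
  finitely supported map from variable indices to exponents.  All indices start at 0: the
  polynomial ring in the variables called $x_1,\dots,x_n$ on paper uses the indices \<open>0, \<dots>, n - 1\<close>.
\<close>

type_synonym cmpoly = "(nat \<Rightarrow>\<^sub>0 nat) \<Rightarrow>\<^sub>0 complex"

definition mconst :: "complex \<Rightarrow> cmpoly" where
  "mconst a = Poly_Mapping.single 0 a"

definition mvar :: "nat \<Rightarrow> cmpoly" where
  "mvar i = Poly_Mapping.single (Poly_Mapping.single i 1) 1"

definition mscale :: "complex \<Rightarrow> cmpoly \<Rightarrow> cmpoly" where
  "mscale a p = Poly_Mapping.map ((*) a) p"

lemma lookup_mscale [simp]:
  "Poly_Mapping.lookup (mscale a p) m = a * Poly_Mapping.lookup p m"
  by (simp add: mscale_def Poly_Mapping.map.rep_eq when_def)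

lemma mscale_eq_mult: "mscale a p = mconst a * p"
proof -
  have "Poly_Mapping.map ((*) a) p = Poly_Mapping.single 0 a * p"
    by (rule mult_map_scale_conv_mult)
  then show ?thesis by (simp add: mscale_def mconst_def)
qed

text \<open>The complex vector space of all polynomials.\<close>

interpretation mpoly: vector_space mscale
  by unfold_locales
    (rule poly_mapping_eqI, simp add: lookup_add algebra_simps)+

definition vars :: "cmpoly \<Rightarrow> nat set" where
  "vars p = (\<Union>m\<in>Poly_Mapping.keys p. Poly_Mapping.keys m)"

text \<open>
  Renaming of variables by a permutation \<open>\<pi>\<close>: the coefficient of \<open>m\<close> in \<open>permute_vars \<pi> p\<close> is the
  coefficient of \<open>m \<circ> \<pi>\<close> in \<open>p\<close>, so that \<open>x\<^sub>i\<close> goes to \<open>x\<^bsub>\<pi> i\<^esub>\<close>.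
\<close>

definition permute_vars :: "(nat \<Rightarrow> nat) \<Rightarrow> cmpoly \<Rightarrow> cmpoly" where
  "permute_vars \<pi> p = Poly_Mapping.map_key (Poly_Mapping.map_key \<pi>) p"

lemma inj_map_key:
  assumes "bij \<pi>"
  shows "inj (Poly_Mapping.map_key \<pi> :: (nat \<Rightarrow>\<^sub>0 nat) \<Rightarrow> _)"
proof (rule injI)
  fix m m' :: "nat \<Rightarrow>\<^sub>0 nat"
  assume eq: "Poly_Mapping.map_key \<pi> m = Poly_Mapping.map_key \<pi> m'"
  have "Poly_Mapping.lookup m (\<pi> i) = Poly_Mapping.lookup m' (\<pi> i)" for i
    using arg_cong[OF eq, of "\<lambda>m. Poly_Mapping.lookup m i"] bij_is_inj[OF assms]
    by (simp add: map_key.rep_eq)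
  then show "m = m'"
    by (intro poly_mapping_eqI) (metis assms bij_is_surj surjD)
qed

lemma lookup_permute_vars:
  assumes "bij \<pi>"
  shows "Poly_Mapping.lookup (permute_vars \<pi> p) m
           = Poly_Mapping.lookup p (Poly_Mapping.map_key \<pi> m)"
  using inj_map_key[OF assms] by (simp add: permute_vars_def map_key.rep_eq)

lemma permute_vars_mvar:
  assumes "bij \<pi>"
  shows "permute_vars \<pi> (mvar i) = mvar (\<pi> i)"
proof -
  have "Poly_Mapping.single i (1::nat) = Poly_Mapping.map_key \<pi> (Poly_Mapping.single (\<pi> i) 1)"
    using bij_is_inj[OF assms] by simp
  then show ?thesis
    using inj_map_key[OF assms] by (simp add: permute_vars_def mvar_def)
qed

definition Sym :: "nat \<Rightarrow> cmpoly set" where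
  "Sym n = {p. vars p \<subseteq> {..<n} \<and> (\<forall>\<pi>. \<pi> permutes {..<n} \<longrightarrow> permute_vars \<pi> p = p)}"


section \<open>Partitions\<close>

text \<open>
  The variable \<open>la\<close> stands for the partition $\lambda$.  Parts are indexed from 0 as well, so
  \<open>la i\<close> is $\lambda_{i+1}$.
\<close>

definition partitions :: "nat \<Rightarrow> (nat \<Rightarrow> nat) set" where
  "partitions n = {la. antimono la \<and> (\<forall>i\<ge>n. la i = 0)}"

definition interlaces :: "(nat \<Rightarrow> nat) \<Rightarrow> (nat \<Rightarrow> nat) \<Rightarrow> bool" (infix \<open>\<preceq>\<close> 50) where
  "\<mu> \<preceq> la \<longleftrightarrow> (\<forall>i. \<mu> i \<le> la i \<and> la (Suc i) \<le> \<mu> i)"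

lemma finite_interlacing: "finite {\<mu> \<in> partitions n. \<mu> \<preceq> la}"
proof (rule finite_subset)
  show "{\<mu> \<in> partitions n. \<mu> \<preceq> la}
      \<subseteq> {\<mu>. \<forall>i. (i \<in> {..<n} \<longrightarrow> \<mu> i \<in> {..Max (la ` {..<n})}) \<and> (i \<notin> {..<n} \<longrightarrow> \<mu> i = 0)}"
  proof
    fix \<mu> assume "\<mu> \<in> {\<mu> \<in> partitions n. \<mu> \<preceq> la}"
    then have supp: "\<forall>i\<ge>n. \<mu> i = 0" and le: "\<mu> i \<le> la i" for i
      by (auto simp: partitions_def interlaces_def)
    have "\<mu> i \<le> Max (la ` {..<n})" if "i < n" for i
      by (rule order_trans[OF le Max_ge]) (use that in auto)
    then show "\<mu> \<in> {\<mu>. \<forall>i. (i \<in> {..<n} \<longrightarrow> \<mu> i \<in> {..Max (la ` {..<n})}) \<and> (i \<notin> {..<n} \<longrightarrow> \<mu> i = 0)}"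
      using supp by simp
  qed
  show "finite {\<mu>. \<forall>i. (i \<in> {..<n} \<longrightarrow> \<mu> i \<in> {..Max (la ` {..<n})}) \<and> (i \<notin> {..<n} \<longrightarrow> \<mu> i = 0)}"
    by (rule finite_set_of_finite_funs) auto
qed


section \<open>Spin $q$-Whittaker polynomials\<close>

definition qpoch :: "'a::comm_ring_1 \<Rightarrow> 'a \<Rightarrow> nat \<Rightarrow> 'a" where
  "qpoch z q k = (\<Prod>i<k. 1 - z * q ^ i)"

text \<open>
  The one-variable skew polynomial.  The factor $x^{|\lambda|-|\mu|}$ is distributed over the
  factors $(c_r/x;q)_{\lambda_r-\mu_r}$, using
  $x^k (c/x;q)_k = \prod_{i<k} (x - c q^i)$; \<open>poly_skewF\<close> below recovers the
  formula with $c_r/x$.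
\<close>

definition skewF ::
  "complex \<Rightarrow> nat \<Rightarrow> (nat \<Rightarrow> complex) \<Rightarrow> (nat \<Rightarrow> complex) \<Rightarrow> (nat \<Rightarrow> nat) \<Rightarrow> (nat \<Rightarrow> nat) \<Rightarrow> complex poly"
where
  "skewF q n c d la \<mu> =
     (if \<mu> \<preceq> la then
        \<Prod>r<n. smult (qpoch q q (la r - la (Suc r)) /
                      (qpoch q q (la r - \<mu> r) * qpoch q q (\<mu> r - la (Suc r)) *
                       qpoch (c r * d r) q (la r - la (Suc r))))
                 ((\<Prod>i<la r - \<mu> r. [:- (c r * q ^ i), 1:]) *
                  qpoch [:0, d r:] [:q:] (\<mu> r - la (Suc r)))
      else 0)"

lemma poly_qpoch: "poly (qpoch z w k) x = qpoch (poly z x) (poly w x) k"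
  by (simp add: qpoch_def poly_prod)

lemma poly_skewF:
  assumes "x \<noteq> 0"
  shows "poly (skewF q n c d la \<mu>) x =
     (if \<mu> \<preceq> la then
        x ^ ((\<Sum>r<n. la r) - (\<Sum>r<n. \<mu> r)) *
        (\<Prod>r<n. qpoch (c r / x) q (la r - \<mu> r) * qpoch (x * d r) q (\<mu> r - la (Suc r)) *
                 qpoch q q (la r - la (Suc r)) /
                 (qpoch q q (la r - \<mu> r) * qpoch q q (\<mu> r - la (Suc r)) *
                  qpoch (c r * d r) q (la r - la (Suc r))))
      else 0)"
proof (cases "\<mu> \<preceq> la")
  case True
  have clear: "x ^ k * qpoch (e / x) q k = (\<Prod>i<k. x - e * q ^ i)" for e k
  proof -
    have "x ^ k * qpoch (e / x) q k = (\<Prod>i<k. x) * (\<Prod>i<k. 1 - e / x * q ^ i)"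
      by (simp add: qpoch_def)
    also have "\<dots> = (\<Prod>i<k. x * (1 - e / x * q ^ i))"
      by (rule prod.distrib[symmetric])
    also have "\<dots> = (\<Prod>i<k. x - e * q ^ i)"
      using assms by (simp add: algebra_simps)
    finally show ?thesis .
  qed
  have "(\<Sum>r<n. la r) - (\<Sum>r<n. \<mu> r) = (\<Sum>r<n. la r - \<mu> r)"
    using True by (simp add: interlaces_def sum_subtractf_nat)
  then have pow: "x ^ ((\<Sum>r<n. la r) - (\<Sum>r<n. \<mu> r)) = (\<Prod>r<n. x ^ (la r - \<mu> r))"
    by (simp add: power_sum)
  have "poly (skewF q n c d la \<mu>) x =
      (\<Prod>r<n. x ^ (la r - \<mu> r) *
        (qpoch (c r / x) q (la r - \<mu> r) * qpoch (x * d r) q (\<mu> r - la (Suc r)) *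
         qpoch q q (la r - la (Suc r)) /
         (qpoch q q (la r - \<mu> r) * qpoch q q (\<mu> r - la (Suc r)) *
          qpoch (c r * d r) q (la r - la (Suc r)))))"
    unfolding skewF_def if_P[OF True] poly_prod
  proof (rule prod.cong[OF refl])
    fix r
    have "poly (\<Prod>i<la r - \<mu> r. [:- (c r * q ^ i), 1:]) x
        = x ^ (la r - \<mu> r) * qpoch (c r / x) q (la r - \<mu> r)"
      unfolding clear poly_prod by simp
    then show "poly (smult (qpoch q q (la r - la (Suc r)) /
                      (qpoch q q (la r - \<mu> r) * qpoch q q (\<mu> r - la (Suc r)) *
                       qpoch (c r * d r) q (la r - la (Suc r))))
                 ((\<Prod>i<la r - \<mu> r. [:- (c r * q ^ i), 1:]) *
                  qpoch [:0, d r:] [:q:] (\<mu> r - la (Suc r)))) x =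
        x ^ (la r - \<mu> r) *
        (qpoch (c r / x) q (la r - \<mu> r) * qpoch (x * d r) q (\<mu> r - la (Suc r)) *
         qpoch q q (la r - la (Suc r)) /
         (qpoch q q (la r - \<mu> r) * qpoch q q (\<mu> r - la (Suc r)) *
          qpoch (c r * d r) q (la r - la (Suc r))))"
      by (simp only: poly_smult poly_mult poly_qpoch) simp
  qed
  then show ?thesis
    using True by (simp only: if_True pow prod.distrib)
qed (simp add: skewF_def)

text \<open>Substitution of the variable with index \<open>i\<close> into a one-variable polynomial.\<close>

definition at_var :: "complex poly \<Rightarrow> nat \<Rightarrow> cmpoly" where
  "at_var p i = poly (map_poly mconst p) (mvar i)"

text \<open>
  In the recursive call the sequence \<open>c\<close> is shifted by one, whereas \<open>d\<close> stays the same; only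
  the first \<open>n\<close> entries of both sequences matter.
\<close>

primrec spinF ::
  "complex \<Rightarrow> nat \<Rightarrow> (nat \<Rightarrow> complex) \<Rightarrow> (nat \<Rightarrow> complex) \<Rightarrow> (nat \<Rightarrow> nat) \<Rightarrow> cmpoly"
where
  "spinF q 0 c d la = 1"
| "spinF q (Suc n) c d la =
     (\<Sum>\<mu> | \<mu> \<in> partitions n \<and> \<mu> \<preceq> la.
        spinF q n (\<lambda>r. c (Suc r)) d \<mu> * at_var (skewF q (Suc n) c d la \<mu>) n)"

end

theory Submission
  imports Defs
begin

text \<open>
  Write \<open>F\<^sub>\<lambda>\<close> for the spin $q$-Whittaker polynomial of \<open>\<lambda>\<close>.

  \<^bold>\<open>Symmetry.\<close>  The recursion treats the variables one at a time, and by induction only the exchange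
  of the last two of them is at stake: the sum over \<open>\<mu>\<close> of the weights of the two steps
  \<open>\<lambda> \<rightarrow> \<mu> \<rightarrow> \<nu>\<close> must not depend on which of the two variables is used first.  Think of \<open>\<lambda>\<close> as a row of
  columns of which the one with index \<open>r\<close> holds \<open>\<lambda>\<^sub>r - \<lambda>\<^bsub>r+1\<^esub>\<close> particles; in the step \<open>\<lambda> \<rightarrow> \<mu>\<close> there are
  \<open>\<lambda>\<^sub>r - \<mu>\<^sub>r\<close> particles that jump from column \<open>r\<close> to column \<open>r - 1\<close>.  As \<open>\<lambda>\<close> and \<open>\<nu>\<close> are fixed, the
  two steps are described by the number of jumps out of every column in the first step alone.  Let
  \<open>Z(p)\<close> be the sum of all weights of the columns \<open>r, r + 1, \<dots>\<close> if \<open>p\<close> particles leave column \<open>r\<close> in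
  the first step, divided by the one factor of these weights that contains both the variable of that
  step and the parameter \<open>c\<^sub>r\<close>.  Exchanging the variables \<open>u, v\<close> changes the function \<open>Z\<close> by the kernel
  \<open>[p choose t]\<^sub>q (u - v)(u - v q) \<dots> (u - v q\<^bsup>p-t-1\<^esup>)\<close> (\<open>two_row_exchange\<close>), because this kernel can be
  moved through one column (\<open>column_exchange\<close>).  That identity for a single column is the
  transformation of Sears for terminating balanced \<open>\<^sub>4\<phi>\<^sub>3\<close> series, and it follows from the \<open>q\<close>-Saalschuetz
  sum.  After the leftmost column the kernel is summed away by the \<open>q\<close>-binomial theorem
  (\<open>two_row_symmetric\<close>).

  \<^bold>\<open>Linear independence.\<close>  If all \<open>n\<close> parts of \<open>\<lambda>\<close> are positive then \<open>F\<^sub>\<lambda>\<close> is a multiple of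
  \<open>\<Prod>\<^sub>i (x\<^sub>i - c\<^sub>n)\<close>, and the quotient is up to a constant the polynomial of \<open>\<lambda>\<close> without its first column
  and with \<open>c\<^sub>n q\<close> in place of \<open>c\<^sub>n\<close> (\<open>meval_spinF_remove_column\<close>).  If \<open>\<lambda>\<close> has fewer than \<open>n\<close> parts then
  \<open>F\<^sub>\<lambda>\<close> at \<open>x\<^sub>1 = c\<^sub>n\<close> is the polynomial of \<open>\<lambda>\<close> in the remaining variables
  (\<open>meval_spinF_at_last_parameter\<close>).  So in a linear relation the point \<open>x\<^sub>1 = c\<^sub>n\<close> isolates the
  partitions with fewer than \<open>n\<close> parts, whose coefficients vanish by induction on \<open>n\<close>; from what is left
  the product can be cancelled, and the largest part has dropped.

  \<^bold>\<open>Spanning.\<close>  The degree of \<open>F\<^sub>\<lambda>\<close> in every single variable is at most \<open>\<lambda>\<^sub>1\<close>.  A symmetric polynomial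
  whose degree in every variable is at most \<open>L\<close> is determined by its coefficients at the monomials
  \<open>x\<^sup>\<lambda>\<close> with \<open>\<lambda>\<^sub>1 \<le> L\<close>.  The space of these polynomials therefore has at most as many dimensions as there
  are such \<open>\<lambda>\<close>, and the independent \<open>F\<^sub>\<lambda>\<close> with \<open>\<lambda>\<^sub>1 \<le> L\<close> fill it.
\<close>

section \<open>Terminating basic hypergeometric sums\<close>

text \<open>
  The homogeneous form \<open>u\<^sup>k (v/u; q)\<^sub>k\<close> of the \<open>q\<close>-shifted factorial.  It is polynomial in \<open>u\<close> and \<open>v\<close>, so
  that no value of a variable has to be excluded anywhere below.
\<close>

definition hpoch :: "complex \<Rightarrow> complex \<Rightarrow> complex \<Rightarrow> nat \<Rightarrow> complex" where
  "hpoch q u v k = (\<Prod>i<k. u - v * q ^ i)"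

lemma hpoch_0 [simp]: "hpoch q u v 0 = 1"
  by (simp add: hpoch_def)

lemma hpoch_Suc: "hpoch q u v (Suc k) = hpoch q u v k * (u - v * q ^ k)"
  by (simp add: hpoch_def)

lemma hpoch_add: "hpoch q u v (j + k) = hpoch q u v j * hpoch q u (v * q ^ j) k"
  by (induction k) (simp_all add: hpoch_Suc power_add algebra_simps)

lemma hpoch_Suc_left: "hpoch q u v (Suc k) = (u - v) * hpoch q u (v * q) k"
  using hpoch_add[of q u v 1 k] by (simp add: hpoch_Suc)

lemma qpoch_eq_hpoch: "qpoch z q k = hpoch q 1 z k"
  by (simp add: qpoch_def hpoch_def)

lemma hpoch_one_nonzero:
  assumes "norm q < 1" "norm z < 1"
  shows "hpoch q 1 z k \<noteq> 0"
proof -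
  have "norm (z * q ^ i) < 1" for i
  proof -
    have "norm (z * q ^ i) \<le> norm z * 1"
      unfolding norm_mult norm_power
      using assms by (intro mult_left_mono power_le_one) auto
    then show ?thesis using assms by simp
  qed
  then have "1 - z * q ^ i \<noteq> 0" for i
    by (metis eq_iff_diff_eq_0 norm_one order_less_irrefl)
  then show ?thesis by (simp add: hpoch_def)
qed

text \<open>
  The bound on \<open>q\<close> keeps every \<open>q\<close>-factorial \<open>(q; q)\<^sub>k\<close> away from 0, and with it the denominators of the
  Gaussian binomial coefficients.  The value \<open>q = 0\<close> is included, so negative powers of \<open>q\<close> are avoided
  throughout.
\<close>

locale q_in_unit_disc =
  fixes q :: complex
  assumes q_lt_1: "norm q < 1"
begin

abbreviation hp :: "complex \<Rightarrow> complex \<Rightarrow> nat \<Rightarrow> complex" where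
  "hp \<equiv> hpoch q"

abbreviation qfact :: "nat \<Rightarrow> complex" where
  "qfact \<equiv> hpoch q 1 q"

definition gbin :: "nat \<Rightarrow> nat \<Rightarrow> complex" where
  "gbin n k = (if k \<le> n then qfact n / (qfact k * qfact (n - k)) else 0)"

lemma qfact_nonzero [simp]: "qfact k \<noteq> 0"
  using hpoch_one_nonzero[OF q_lt_1 q_lt_1] .

lemma qfact_Suc: "qfact (Suc n) = qfact n * (1 - q ^ Suc n)"
  by (simp add: hpoch_Suc)

lemma one_minus_q_power_nonzero: "1 - q ^ Suc n \<noteq> 0"
  using qfact_Suc[of n] qfact_nonzero[of "Suc n"] by auto

lemma qfact_split: "k \<le> n \<Longrightarrow> qfact n = qfact (n - k) * hp 1 (q ^ (n - k + 1)) k"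
  using hpoch_add[of q 1 q "n - k" k] by simp

lemma gbin_0 [simp]: "gbin n 0 = 1"
  by (simp add: gbin_def)

lemma gbin_self [simp]: "gbin n n = 1"
  by (simp add: gbin_def)

lemma gbin_eq_0 [simp]: "n < k \<Longrightarrow> gbin n k = 0"
  by (simp add: gbin_def)

lemma gbin_pascal: "gbin (Suc n) (Suc k) = q ^ Suc k * gbin n (Suc k) + gbin n k"
proof (cases "k < n")
  case True
  then obtain m where m: "n = k + Suc m"
    using less_imp_Suc_add by fastforce
  show ?thesis
    unfolding gbin_def m using one_minus_q_power_nonzero[of k] one_minus_q_power_nonzero[of m]
    by (simp add: qfact_Suc divide_simps del: power_Suc) (simp add: algebra_simps power_add)
qed (auto simp: gbin_def)

lemma gbin_pascal':
  assumes "k \<le> n"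
  shows "gbin (Suc n) (Suc k) = gbin n (Suc k) + q ^ (n - k) * gbin n k"
proof (cases "k < n")
  case True
  then obtain m where m: "n = k + Suc m"
    using less_imp_Suc_add by fastforce
  show ?thesis
    unfolding gbin_def m using one_minus_q_power_nonzero[of k] one_minus_q_power_nonzero[of m]
    by (simp add: qfact_Suc divide_simps del: power_Suc) (simp add: algebra_simps power_add)
qed (use assms in \<open>auto simp: gbin_def\<close>)

definition saal_coeff :: "complex \<Rightarrow> nat \<Rightarrow> nat \<Rightarrow> complex" where
  "saal_coeff w M J = gbin M J * hp 1 (w * q ^ (M - J)) J"

lemma saal_coeff_0 [simp]: "saal_coeff w M 0 = 1"
  by (simp add: saal_coeff_def)

lemma saal_coeff_eq_0 [simp]: "M < J \<Longrightarrow> saal_coeff w M J = 0"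
  by (simp add: saal_coeff_def)

text \<open>
  After division by the common factors both sides are linear in \<open>w\<close>.  The constant terms give one of the
  two \<open>q\<close>-Pascal rules, and the coefficients of \<open>w\<close> give the other one.
\<close>

lemma saal_coeff_Suc_Suc:
  "saal_coeff w (Suc M) (Suc J) = q ^ Suc J * saal_coeff w M (Suc J) + (1 - w * q ^ (2 * M - J)) * saal_coeff w M J"
proof -
  consider "M < J" | "J = M" | "J < M" by linarith
  then show ?thesis
  proof cases
    case 2
    have "M * 2 - M = M" by simp
    with 2 show ?thesis by (simp add: saal_coeff_def hpoch_Suc mult_2)
  next
    case 3
    then obtain m where m: "M = J + Suc m"
      using less_imp_Suc_add by fastforce
    define H where "H = hp 1 (w * q ^ Suc m) J"
    have 1: "saal_coeff w (Suc M) (Suc J) = gbin (Suc M) (Suc J) * (H * (1 - w * q ^ M))"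
      by (simp add: saal_coeff_def m H_def hpoch_Suc power_add mult_ac)
    have 2: "saal_coeff w M (Suc J) = gbin M (Suc J) * ((1 - w * q ^ m) * H)"
      by (simp add: saal_coeff_def m H_def hpoch_Suc_left mult_ac)
    have 3: "saal_coeff w M J = gbin M J * H"
      by (simp add: saal_coeff_def m H_def)
    have p: "q ^ (2 * M - J) = q ^ M * q ^ Suc m"
      by (simp add: m mult_2 add.assoc flip: power_add)
    have p': "q ^ M = q ^ Suc J * q ^ m"
      by (simp add: m power_add)
    have e1: "gbin (Suc M) (Suc J) = q ^ Suc J * gbin M (Suc J) + gbin M J"
      by (rule gbin_pascal)
    have e2: "gbin (Suc M) (Suc J) = gbin M (Suc J) + q ^ Suc m * gbin M J"
      using gbin_pascal'[of J M] by (simp add: m)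
    have "gbin (Suc M) (Suc J) * (1 - w * q ^ M)
        = gbin (Suc M) (Suc J) - w * q ^ M * gbin (Suc M) (Suc J)"
      by (simp add: algebra_simps)
    also have "\<dots> = (q ^ Suc J * gbin M (Suc J) + gbin M J)
        - w * q ^ M * (gbin M (Suc J) + q ^ Suc m * gbin M J)"
      by (subst e1, subst e2) (rule refl)
    finally have "gbin (Suc M) (Suc J) * (1 - w * q ^ M)
        = q ^ Suc J * gbin M (Suc J) * (1 - w * q ^ m)
          + (1 - w * q ^ (2 * M - J)) * gbin M J"
      unfolding p by (simp add: p' algebra_simps del: power_Suc)
    then have "H * (gbin (Suc M) (Suc J) * (1 - w * q ^ M))
        = H * (q ^ Suc J * gbin M (Suc J) * (1 - w * q ^ m)
          + (1 - w * q ^ (2 * M - J)) * gbin M J)"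
      by (rule arg_cong)
    then show ?thesis
      unfolding 1 2 3 by (simp only: algebra_simps)
  qed simp
qed

text \<open>
  A consistency property of the coefficients: expanding \<open>m + k\<close> factors at once, or \<open>m\<close> of them first and
  the other \<open>k\<close> afterwards, must give the same result.  Both sides satisfy the recurrence
  \<open>saal_coeff_Suc_Suc\<close> in \<open>k\<close>.
\<close>

lemma saal_coeff_convolution:
  "(\<Sum>j\<le>J. saal_coeff w m j * (q ^ (j * (k - (J - j))) * saal_coeff (w * q ^ (2 * m - j)) k (J - j)))
     = saal_coeff w (m + k) J"
proof (induction k arbitrary: J)
  case 0
  have "(\<Sum>j\<le>J. saal_coeff w m j * (q ^ (j * (0 - (J - j))) * saal_coeff (w * q ^ (2 * m - j)) 0 (J - j)))
      = (\<Sum>j\<le>J. if j = J then saal_coeff w m J else 0)"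
    by (rule sum.cong) auto
  then show ?case by simp
next
  case (Suc k)
  show ?case
  proof (cases J)
    case (Suc I)
    let ?s = "\<lambda>k j i. q ^ (j * (k - i)) * saal_coeff (w * q ^ (2 * m - j)) k i"
    have step: "saal_coeff w m j * ?s (Suc k) j (Suc I - j)
        = q ^ Suc I * (saal_coeff w m j * ?s k j (Suc I - j))
          + (1 - w * q ^ (2 * (m + k) - I)) * (saal_coeff w m j * ?s k j (I - j))" if "j \<le> I" for j
    proof (cases "j \<le> m \<and> I - j \<le> k")
      case True
      then have e: "2 * m - j + (2 * k - (I - j)) = 2 * (m + k) - I"
        using that by auto
      define i where "i = I - j"
      have i: "I = j + i" "i \<le> k"
        using that True by (auto simp: i_def)
      let ?w = "w * q ^ (2 * m - j)"
      have A: "?w * q ^ (2 * k - i) = w * q ^ (2 * (m + k) - I)"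
        using e by (simp add: i_def mult.assoc flip: power_add)
      have B: "q ^ (j * (k - i)) * (q ^ Suc i * saal_coeff ?w k (Suc i)) = q ^ Suc I * ?s k j (Suc i)"
      proof (cases "i < k")
        case True
        then obtain l where "k = Suc (i + l)" using less_imp_Suc_add by blast
        then show ?thesis by (simp add: i power_add algebra_simps)
      qed simp
      have "?s (Suc k) j (Suc i)
          = q ^ (j * (k - i)) * (q ^ Suc i * saal_coeff ?w k (Suc i)) + (1 - ?w * q ^ (2 * k - i)) * ?s k j i"
        unfolding saal_coeff_Suc_Suc diff_Suc_Suc by (simp only: distrib_left mult.assoc mult.left_commute)
      also have "\<dots> = q ^ Suc I * ?s k j (Suc i) + (1 - w * q ^ (2 * (m + k) - I)) * ?s k j i"
        unfolding A B ..
      finally show ?thesis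
        unfolding Suc_diff_le[OF that] i_def[symmetric]
        by (simp only: distrib_left mult.left_commute)
    next
      case False
      then show ?thesis
        using that by (auto simp: Suc_diff_le)
    qed
    have last: "saal_coeff w m (Suc I) * ?s (Suc k) (Suc I) 0 = q ^ Suc I * (saal_coeff w m (Suc I) * ?s k (Suc I) 0)"
      by (simp add: power_add mult_ac)
    have "(\<Sum>j\<le>Suc I. saal_coeff w m j * ?s (Suc k) j (Suc I - j))
        = q ^ Suc I * (\<Sum>j\<le>Suc I. saal_coeff w m j * ?s k j (Suc I - j))
          + (1 - w * q ^ (2 * (m + k) - I)) * (\<Sum>j\<le>I. saal_coeff w m j * ?s k j (I - j))"
    proof -
      have "(\<Sum>j\<le>Suc I. saal_coeff w m j * ?s (Suc k) j (Suc I - j))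
        = (\<Sum>j\<le>I. q ^ Suc I * (saal_coeff w m j * ?s k j (Suc I - j))
          + (1 - w * q ^ (2 * (m + k) - I)) * (saal_coeff w m j * ?s k j (I - j)))
          + q ^ Suc I * (saal_coeff w m (Suc I) * ?s k (Suc I) 0)"
        unfolding sum.atMost_Suc using step last by simp
      then show ?thesis
        by (simp add: sum.distrib sum_distrib_left distrib_left del: power_Suc)
    qed
    also have "\<dots> = saal_coeff w (m + Suc k) (Suc I)"
      unfolding Suc.IH by (simp add: saal_coeff_Suc_Suc del: power_Suc)
    finally show ?thesis
      using Suc by simp
  qed simp
qed

text \<open>
  The products in \<open>x\<close> in terms of which both sides of the Saalschuetz and Sears identities are expanded.
\<close>

definition saal_prod :: "complex \<Rightarrow> complex \<Rightarrow> complex \<Rightarrow> complex \<Rightarrow> nat \<Rightarrow> nat \<Rightarrow> nat \<Rightarrow> complex" where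
  "saal_prod x y C d a b j = hp 1 (x * d) (a - j) * hp x y j * hp y C (b - j)"

text \<open>
  Adding one factor of each of the two kinds \<open>1 - y d q\<^sup>a\<close> and \<open>x - C q\<^sup>b\<close> moves a product to only two
  neighbours.  After division by the common factors this is the case \<open>k = 1\<close> of \<open>q_saalschuetz\<close>.
\<close>

lemma saal_prod_step:
  assumes "j \<le> a" "j \<le> b"
  shows "(1 - y * d * q ^ a) * (x - C * q ^ b) * saal_prod x y C d a b j
       = q ^ j * saal_prod x y C d (Suc a) (Suc b) j
         + (1 - C * d * q ^ (a + b - j)) * saal_prod x y C d (Suc a) (Suc b) (Suc j)"
proof -
  obtain s t where st: "a = j + s" "b = j + t"
    using assms le_Suc_ex by blast
  define H where "H = hp 1 (x * d) s * hp x y j * hp y C t"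
  have 1: "saal_prod x y C d a b j = H"
    by (simp add: saal_prod_def st H_def)
  have 2: "saal_prod x y C d (Suc a) (Suc b) j = H * ((1 - x * d * q ^ s) * (y - C * q ^ t))"
    by (simp add: saal_prod_def st H_def Suc_diff_le hpoch_Suc)
  have 3: "saal_prod x y C d (Suc a) (Suc b) (Suc j) = H * (x - y * q ^ j)"
    by (simp add: saal_prod_def st H_def hpoch_Suc)
  have "(1 - y * d * q ^ a) * (x - C * q ^ b)
      = q ^ j * ((1 - x * d * q ^ s) * (y - C * q ^ t))
        + (1 - C * d * q ^ (a + b - j)) * (x - y * q ^ j)"
    by (simp add: st power_add algebra_simps)
  then have "H * ((1 - y * d * q ^ a) * (x - C * q ^ b))
      = H * (q ^ j * ((1 - x * d * q ^ s) * (y - C * q ^ t))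
        + (1 - C * d * q ^ (a + b - j)) * (x - y * q ^ j))"
    by (rule arg_cong)
  then show ?thesis
    unfolding 1 2 3 by (simp only: distrib_left mult_ac)
qed

text \<open>
  Iteration of \<open>saal_prod_step\<close>.  The coefficients that arise obey the recurrence of \<open>saal_coeff\<close>.
\<close>

lemma saal_prod_expansion:
  assumes "j \<le> a" "j \<le> b"
  shows "hp 1 (y * d * q ^ a) k * hp x (C * q ^ b) k * saal_prod x y C d a b j
       = (\<Sum>i\<le>k. q ^ (j * (k - i)) * saal_coeff (C * d * q ^ (a + b - j)) k i
                * saal_prod x y C d (a + k) (b + k) (j + i))"
proof (induction k)
  case (Suc k)
  let ?w = "C * d * q ^ (a + b - j)"
  let ?K = "\<lambda>k i. saal_prod x y C d (a + k) (b + k) (j + i)"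
  let ?s = "\<lambda>k i. q ^ (j * (k - i)) * saal_coeff ?w k i"
  have step: "(1 - y * d * q ^ (a + k)) * (x - C * q ^ (b + k)) * (?s k i * ?K k i)
      = q ^ (j + i) * ?s k i * ?K (Suc k) i + (1 - ?w * q ^ (2 * k - i)) * ?s k i * ?K (Suc k) (Suc i)"
    if "i \<le> k" for i
  proof -
    have e: "a + k + (b + k) - (j + i) = (a + b - j) + (2 * k - i)"
      using assms that by linarith
    have "(1 - y * d * q ^ (a + k)) * (x - C * q ^ (b + k)) * ?K k i
       = q ^ (j + i) * ?K (Suc k) i + (1 - ?w * q ^ (2 * k - i)) * ?K (Suc k) (Suc i)"
      using saal_prod_step[of "j + i" "a + k" "b + k" y d x C] assms that
      unfolding e power_add[of q "a + b - j"]
      by (simp add: power_add[of q a] power_add[of q b] power_add[of q j] mult.assoc)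
    then have "?s k i * ((1 - y * d * q ^ (a + k)) * (x - C * q ^ (b + k)) * ?K k i)
       = ?s k i * (q ^ (j + i) * ?K (Suc k) i + (1 - ?w * q ^ (2 * k - i)) * ?K (Suc k) (Suc i))"
      by (rule arg_cong)
    then show ?thesis by (simp only: distrib_left mult_ac)
  qed
  have s_rec: "?s (Suc k) (Suc i) = q ^ (j + Suc i) * ?s k (Suc i) + (1 - ?w * q ^ (2 * k - i)) * ?s k i"
    if "i \<le> k" for i
  proof -
    have "q ^ (j * (k - i)) * (q ^ Suc i * saal_coeff ?w k (Suc i)) = q ^ (j + Suc i) * ?s k (Suc i)"
    proof (cases "i < k")
      case True
      then obtain l where "k = Suc (i + l)" using less_imp_Suc_add by blast
      then show ?thesis by (simp add: power_add algebra_simps)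
    qed simp
    moreover have "?s (Suc k) (Suc i)
        = q ^ (j * (k - i)) * (q ^ Suc i * saal_coeff ?w k (Suc i)) + (1 - ?w * q ^ (2 * k - i)) * ?s k i"
      unfolding saal_coeff_Suc_Suc diff_Suc_Suc by (simp only: distrib_left mult.assoc mult.left_commute)
    ultimately show ?thesis by simp
  qed
  have "hp 1 (y * d * q ^ a) (Suc k) * hp x (C * q ^ b) (Suc k) * saal_prod x y C d a b j
      = (1 - y * d * q ^ (a + k)) * (x - C * q ^ (b + k))
        * (hp 1 (y * d * q ^ a) k * hp x (C * q ^ b) k * saal_prod x y C d a b j)"
    by (simp add: hpoch_Suc power_add mult_ac)
  also have "\<dots> = (\<Sum>i\<le>k. q ^ (j + i) * ?s k i * ?K (Suc k) i)
        + (\<Sum>i\<le>k. (1 - ?w * q ^ (2 * k - i)) * ?s k i * ?K (Suc k) (Suc i))"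
    unfolding Suc.IH sum_distrib_left sum.distrib[symmetric] by (intro sum.cong refl step) simp
  also have "(\<Sum>i\<le>k. q ^ (j + i) * ?s k i * ?K (Suc k) i)
      = (\<Sum>i\<le>Suc k. q ^ (j + i) * ?s k i * ?K (Suc k) i)"
    by simp
  also have "\<dots> = ?s (Suc k) 0 * ?K (Suc k) 0 + (\<Sum>i\<le>k. q ^ (j + Suc i) * ?s k (Suc i) * ?K (Suc k) (Suc i))"
    by (subst sum.atMost_Suc_shift) (simp add: power_add mult_ac)
  also have "\<dots> + (\<Sum>i\<le>k. (1 - ?w * q ^ (2 * k - i)) * ?s k i * ?K (Suc k) (Suc i))
      = ?s (Suc k) 0 * ?K (Suc k) 0 + (\<Sum>i\<le>k. ?s (Suc k) (Suc i) * ?K (Suc k) (Suc i))"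
    unfolding add.assoc sum.distrib[symmetric] distrib_right[symmetric]
    by (intro arg_cong2[where f = "(+)"] sum.cong refl) (simp only: s_rec atMost_iff)
  also have "\<dots> = (\<Sum>i\<le>Suc k. ?s (Suc k) i * ?K (Suc k) i)"
    by (subst sum.atMost_Suc_shift) simp
  finally show ?case .
qed simp

lemma q_saalschuetz:
  "hp 1 (y * d) k * hp x C k
     = (\<Sum>i\<le>k. saal_coeff (C * d) k i * (hp 1 (x * d) (k - i) * hp x y i * hp y C (k - i)))"
  using saal_prod_expansion[of 0 0 0 y d k x C] by (simp add: saal_prod_def)

lemma q_binomial_convolution:
  "hp x C k = (\<Sum>i\<le>k. gbin k i * hp x y i * hp y C (k - i))"
  using q_saalschuetz[of y 0 k x C] by (simp add: saal_coeff_def hpoch_def mult.assoc)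

text \<open>
  With \<open>N\<close> fixed, the part of the summand of a balanced \<open>\<^sub>4\<phi>\<^sub>3\<close> series that consists of \<open>q\<close>-factorials,
  normalised so that it is symmetric in \<open>a\<close> and \<open>b\<close>.
\<close>

definition sears_coeff :: "nat \<Rightarrow> nat \<Rightarrow> nat \<Rightarrow> nat \<Rightarrow> complex" where
  "sears_coeff a b N j =
     (if j \<le> a \<and> j \<le> b
      then qfact a * qfact b * qfact (N - j) / (qfact j * qfact (a - j) * qfact (b - j)) else 0)"

lemma sears_coeff_commute: "sears_coeff a b = sears_coeff b a"
  by (intro ext) (simp add: sears_coeff_def mult_ac)

text \<open>
  Up to \<open>q\<close>-factorials independent of \<open>j\<close> this is \<open>saal_coeff_convolution\<close> at the value
  \<open>w = q\<^bsup>b-a+1\<^esup>\<close>, where every shifted factorial becomes a quotient of \<open>q\<close>-factorials.  For \<open>a > b\<close> this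
  exponent may be negative, and the symmetry in \<open>a\<close> and \<open>b\<close> is used instead.
\<close>

lemma sears_coeff_convolution:
  assumes N: "N = a + b + k"
  shows "(\<Sum>j\<le>J. sears_coeff a b N j * (q ^ (j * (k - (J - j))) * gbin k (J - j)))
       = sears_coeff (a + k) (b + k) N J"
proof -
  have main: "(\<Sum>j\<le>J. sears_coeff a b N j * (q ^ (j * (k - (J - j))) * gbin k (J - j)))
       = sears_coeff (a + k) (b + k) N J" if N: "N = a + b + k" and ab: "a \<le> b" for a b
  proof (cases "J \<le> a + k")
    case False
    have "sears_coeff a b N j * (q ^ (j * (k - (J - j))) * gbin k (J - j)) = 0" for j
      using False by (cases "j \<le> a") (auto simp: sears_coeff_def)
    then have "(\<Sum>j\<le>J. sears_coeff a b N j * (q ^ (j * (k - (J - j))) * gbin k (J - j))) = 0"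
      by (intro sum.neutral ballI)
    then show ?thesis
      using False by (simp add: sears_coeff_def)
  next
    case True
    define w where "w = q ^ (b - a + 1)"
    have term_eq: "sears_coeff a b N j * (q ^ (j * (k - (J - j))) * gbin k (J - j))
        = qfact (N - J) * (saal_coeff w a j * (q ^ (j * (k - (J - j))) * saal_coeff (w * q ^ (2 * a - j)) k (J - j)))"
      if "j \<le> J" for j
    proof (cases "j \<le> a \<and> J - j \<le> k")
      case False
      then show ?thesis by (auto simp: sears_coeff_def)
    next
      case in_range: True
      have e1: "b - a + 1 + (a - j) = b - j + 1" and e2: "b - a + 1 + (2 * a - j) + (k - (J - j)) = N - j - (J - j) + 1"
        and e3: "N - j - (J - j) = N - J"
        using ab in_range that N by linarith+
      let ?h = "hp 1 (q ^ (b - j + 1)) j"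
      let ?h' = "hp 1 (q ^ (N - j - (J - j) + 1)) (J - j)"
      have 1: "saal_coeff w a j = gbin a j * ?h"
        unfolding saal_coeff_def w_def e1[symmetric] power_add ..
      have 2: "saal_coeff (w * q ^ (2 * a - j)) k (J - j) = gbin k (J - j) * ?h'"
        unfolding saal_coeff_def w_def e2[symmetric] power_add ..
      have "qfact b = qfact (b - j) * ?h"
        by (rule qfact_split) (use ab in_range in linarith)
      then have 3: "qfact b / qfact (b - j) = ?h"
        by (metis nonzero_mult_div_cancel_left qfact_nonzero)
      have 4: "qfact (N - j) = qfact (N - J) * ?h'"
        using qfact_split[of "J - j" "N - j"] N True ab unfolding e3 by linarith
      have 5: "gbin a j = qfact a / (qfact j * qfact (a - j))"
        using in_range by (simp add: gbin_def)
      have "sears_coeff a b N j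
          = (qfact a / (qfact j * qfact (a - j))) * (qfact b / qfact (b - j)) * qfact (N - j)"
        using in_range ab by (simp add: sears_coeff_def)
      then have "sears_coeff a b N j = gbin a j * ?h * (qfact (N - J) * ?h')"
        unfolding 3 4 5 .
      then show ?thesis
        unfolding 1 2 by (simp only: mult_ac)
    qed
    have e1: "b - a + 1 + (a + k - J) = b + k - J + 1"
      using ab True by linarith
    let ?h = "hp 1 (q ^ (b + k - J + 1)) J"
    have 1: "saal_coeff w (a + k) J = gbin (a + k) J * ?h"
      unfolding saal_coeff_def w_def e1[symmetric] power_add ..
    have "qfact (b + k) = qfact (b + k - J) * ?h"
      by (rule qfact_split) (use ab True in linarith)
    then have 2: "qfact (b + k) / qfact (b + k - J) = ?h"
      by (metis nonzero_mult_div_cancel_left qfact_nonzero)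
    have 3: "gbin (a + k) J = qfact (a + k) / (qfact J * qfact (a + k - J))"
      using True by (simp add: gbin_def)
    have "sears_coeff (a + k) (b + k) N J
        = (qfact (a + k) / (qfact J * qfact (a + k - J))) * (qfact (b + k) / qfact (b + k - J)) * qfact (N - J)"
      using True ab by (simp add: sears_coeff_def)
    then have "sears_coeff (a + k) (b + k) N J = qfact (N - J) * saal_coeff w (a + k) J"
      unfolding 1 2 3 by (simp only: mult_ac)
    moreover have "(\<Sum>j\<le>J. sears_coeff a b N j * (q ^ (j * (k - (J - j))) * gbin k (J - j)))
        = (\<Sum>j\<le>J. qfact (N - J)
             * (saal_coeff w a j * (q ^ (j * (k - (J - j))) * saal_coeff (w * q ^ (2 * a - j)) k (J - j))))"
      by (intro sum.cong refl term_eq) simp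
    ultimately show ?thesis
      by (simp only: saal_coeff_convolution flip: sum_distrib_left)
  qed
  show ?thesis
  proof (cases "a \<le> b")
    case True
    then show ?thesis using main N by blast
  next
    case False
    then show ?thesis
      using main[of b a] N sears_coeff_commute[of a b] sears_coeff_commute[of "a + k" "b + k"] by simp
  qed
qed

definition sears_sum where
  "sears_sum x y C d N a b = (\<Sum>j\<le>a. sears_coeff a b N j * saal_prod x y C d a b j / hp 1 (C * d) (N - j))"

text \<open>
  Multiply the sum by \<open>2k\<close> linear factors and expand each product by \<open>saal_prod_expansion\<close>.  The two
  shifted factorials that contain \<open>C d\<close> merge into one that depends on \<open>i + j\<close> only, so that the
  coefficients can be collected with \<open>sears_coeff_convolution\<close>.
\<close>

lemma sears_raise:
  assumes Cd: "norm (C * d) < 1" and N: "N = a + b + k"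
  shows "hp 1 (y * d * q ^ a) k * hp x (C * q ^ b) k * sears_sum x y C d N a b
       = sears_sum x y C d N (a + k) (b + k)"
proof -
  let ?K = "saal_prod x y C d (a + k) (b + k)"
  let ?g = "\<lambda>j i. sears_coeff a b N j * (q ^ (j * (k - i)) * gbin k i)
               * (?K (j + i) / hp 1 (C * d) (N - (j + i)))"
  have nz: "hp 1 (C * d) m \<noteq> 0" for m
    using hpoch_one_nonzero[OF q_lt_1 Cd] .
  have term_eq: "hp 1 (y * d * q ^ a) k * hp x (C * q ^ b) k
        * (sears_coeff a b N j * saal_prod x y C d a b j / hp 1 (C * d) (N - j)) = (\<Sum>i\<le>k. ?g j i)" if "j \<le> a" for j
  proof (cases "j \<le> b")
    case False
    then show ?thesis by (simp add: sears_coeff_def)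
  next
    case True
    have "hp 1 (y * d * q ^ a) k * hp x (C * q ^ b) k
        * (sears_coeff a b N j * saal_prod x y C d a b j / hp 1 (C * d) (N - j))
       = sears_coeff a b N j / hp 1 (C * d) (N - j) *
         (hp 1 (y * d * q ^ a) k * hp x (C * q ^ b) k * saal_prod x y C d a b j)"
      by simp
    also have "\<dots> = (\<Sum>i\<le>k. sears_coeff a b N j / hp 1 (C * d) (N - j) *
        (q ^ (j * (k - i)) * saal_coeff (C * d * q ^ (a + b - j)) k i * ?K (j + i)))"
      unfolding saal_prod_expansion[OF that True] sum_distrib_left ..
    also have "\<dots> = (\<Sum>i\<le>k. ?g j i)"
    proof (rule sum.cong[OF refl])
      fix i assume "i \<in> {..k}"
      then have i: "i \<le> k" by simp
      have e: "N - j = (N - (j + i)) + i" "N - (j + i) = a + b - j + (k - i)"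
        using i that True N by linarith+
      have "hp 1 (C * d) (N - j) = hp 1 (C * d) (N - (j + i)) * hp 1 (C * d * q ^ (N - (j + i))) i"
        by (subst e(1)) (rule hpoch_add)
      moreover have "C * d * q ^ (N - (j + i)) = C * d * q ^ (a + b - j) * q ^ (k - i)"
        unfolding e(2) by (simp add: power_add)
      ultimately show "sears_coeff a b N j / hp 1 (C * d) (N - j) *
        (q ^ (j * (k - i)) * saal_coeff (C * d * q ^ (a + b - j)) k i * ?K (j + i)) = ?g j i"
        using nz[of "N - j"] by (simp add: saal_coeff_def)
    qed
    finally show ?thesis .
  qed
  have "hp 1 (y * d * q ^ a) k * hp x (C * q ^ b) k * sears_sum x y C d N a b
      = (\<Sum>j\<le>a. \<Sum>i\<le>k. ?g j i)"
    unfolding sears_sum_def sum_distrib_left by (intro sum.cong refl term_eq) simp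
  also have "\<dots> = (\<Sum>(j, i) \<in> {..a} \<times> {..k}. ?g j i)"
    by (simp add: sum.cartesian_product)
  also have "\<dots> = (\<Sum>(j, i) \<in> {(j, i). j + i \<le> a + k}. ?g j i)"
  proof (rule sum.mono_neutral_left)
    show "finite {(j, i). j + i \<le> a + k}"
      by (rule finite_subset[of _ "{..a + k} \<times> {..a + k}"]) auto
    show "\<forall>ji\<in>{(j, i). j + i \<le> a + k} - {..a} \<times> {..k}. (case ji of (j, i) \<Rightarrow> ?g j i) = 0"
    proof
      fix ji assume ji: "ji \<in> {(j, i). j + i \<le> a + k} - {..a} \<times> {..k}"
      obtain j i where ji_eq: "ji = (j, i)"
        by (cases ji)
      have "sears_coeff a b N j = 0 \<or> gbin k i = 0"
        using ji by (auto simp: ji_eq sears_coeff_def)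
      then show "(case ji of (j, i) \<Rightarrow> ?g j i) = 0"
        by (auto simp: ji_eq)
    qed
  qed auto
  also have "\<dots> = (\<Sum>J\<le>a + k. \<Sum>j\<le>J. ?g j (J - j))"
    by (rule sum.triangle_reindex_eq)
  also have "\<dots> = (\<Sum>J\<le>a + k. (\<Sum>j\<le>J. sears_coeff a b N j * (q ^ (j * (k - (J - j))) * gbin k (J - j)))
                     * (?K J / hp 1 (C * d) (N - J)))"
    unfolding sum_distrib_right by (intro sum.cong refl) simp
  also have "\<dots> = sears_sum x y C d N (a + k) (b + k)"
    unfolding sears_coeff_convolution[OF N] sears_sum_def by simp
  finally show ?thesis .
qed

text \<open>
  The map \<open>(a, b) \<mapsto> (N - b, N - a)\<close> is an involution that turns \<open>a + b \<le> N\<close> into \<open>a + b \<ge> N\<close>, and in the first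
  case the identity is \<open>sears_raise\<close> with \<open>k = N - a - b\<close>.
\<close>

lemma sears_transformation:
  assumes Cd: "norm (C * d) < 1" and "a \<le> N" "b \<le> N"
  shows "hp 1 (y * d) (N - b) * hp x C (N - a) * sears_sum x y C d N a b
       = hp 1 (y * d) a * hp x C b * sears_sum x y C d N (N - b) (N - a)"
proof -
  have main: "hp 1 (y * d) (N - b) * hp x C (N - a) * sears_sum x y C d N a b
       = hp 1 (y * d) a * hp x C b * sears_sum x y C d N (N - b) (N - a)" if ab: "a + b \<le> N" for a b
  proof -
    obtain k where k: "N = a + b + k"
      using le_Suc_ex[OF ab] by blast
    have e: "N - b = a + k" "N - a = b + k"
      by (simp_all add: k)
    have "hp 1 (y * d) (a + k) * hp x C (b + k) * sears_sum x y C d N a b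
        = hp 1 (y * d) a * hp x C b
          * (hp 1 (y * d * q ^ a) k * hp x (C * q ^ b) k * sears_sum x y C d N a b)"
      unfolding hpoch_add[of q 1 "y * d" a k] hpoch_add[of q x C b k] by (simp only: mult_ac)
    then show ?thesis
      unfolding e sears_raise[OF Cd k] .
  qed
  show ?thesis
  proof (cases "a + b \<le> N")
    case False
    then have "N - b + (N - a) \<le> N" by linarith
    from main[OF this] show ?thesis
      unfolding diff_diff_cancel[OF assms(2)] diff_diff_cancel[OF assms(3)] by (rule sym)
  qed (rule main)
qed

lemma sears_sum_commuted_range:
  "sears_sum x y C d N a b = (\<Sum>j\<le>b. sears_coeff a b N j * saal_prod x y C d a b j / hp 1 (C * d) (N - j))"
proof -
  have "sears_sum x y C d N a b
    = (\<Sum>j\<le>max a b. sears_coeff a b N j * saal_prod x y C d a b j / hp 1 (C * d) (N - j))"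
    unfolding sears_sum_def by (rule sum.mono_neutral_left) (auto simp: sears_coeff_def)
  also have "\<dots> = (\<Sum>j\<le>b. sears_coeff a b N j * saal_prod x y C d a b j / hp 1 (C * d) (N - j))"
    by (rule sum.mono_neutral_right) (auto simp: sears_coeff_def)
  finally show ?thesis .
qed

section \<open>The two-row partition function\<close>

lemma gbin_commute: "k \<le> n \<Longrightarrow> gbin n (n - k) = gbin n k"
  by (simp add: gbin_def mult.commute)

lemma gbin_mult_gbin: "gbin a (p + j) * gbin (p + j) p = gbin a p * gbin (a - p) j"
proof (cases "p + j \<le> a")
  case True
  then have j: "j \<le> a - p" "p \<le> a" "p \<le> p + j" by auto
  show ?thesis
    unfolding gbin_def if_P[OF True] if_P[OF j(1)] if_P[OF j(2)] if_P[OF j(3)] by simp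
next
  case False
  then have "\<not> j \<le> a - p \<or> \<not> p \<le> a" by linarith
  with False show ?thesis by (auto simp: gbin_eq_0)
qed

text \<open>
  The weight of one column that holds \<open>a\<close> particles at the start.  In the step with the variable \<open>u\<close> it
  loses \<open>p\<close> particles and receives \<open>P\<close>; in the step with the variable \<open>v\<close> it loses \<open>k - p\<close> of the
  \<open>a - p + P\<close> that it now holds.  Two factors are left out.  One is \<open>hp u c p\<close> with the parameter \<open>c\<close> of the
  first step: it would put the quotient \<open>hp v c t / hp u c p\<close> into the exchange kernel, which would then be
  singular at zeros of the denominator.  The other one depends on \<open>a\<close> alone.
\<close>

definition col_weight ::
    "complex \<Rightarrow> complex \<Rightarrow> complex \<Rightarrow> complex \<Rightarrow> nat \<Rightarrow> nat \<Rightarrow> nat \<Rightarrow> nat \<Rightarrow> complex" where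
  "col_weight u v C d a k p P =
     (if p \<le> k
      then gbin a p * hp 1 (u * d) (a - p) *
           (gbin (a - p + P) (k - p) * hp v C (k - p) * hp 1 (v * d) (a + P - k) / hp 1 (C * d) (a - p + P))
      else 0)"

lemma col_weight_left_sum:
  assumes "t \<le> a" "t \<le> k" "k \<le> a + P" and defs: "A = a - t" "n = k - t" "N = A + P"
  shows "(\<Sum>p\<le>a. gbin p t * hp u v (p - t) * col_weight u v C d a k p P)
       = gbin a t / (qfact n * qfact (N - n)) * (hp 1 (v * d) (N - n) * sears_sum u v C d N A n)"
proof -
  have Nn: "N - n = a + P - k"
    using assms(1,2) by (simp add: defs)
  let ?f = "\<lambda>p. gbin p t * hp u v (p - t) * col_weight u v C d a k p P"
  \<comment> \<open>The terms with \<open>p < t\<close> vanish, and \<open>j = p - t\<close> becomes the summation index.\<close>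
  have "(\<Sum>p\<le>a. ?f p) = (\<Sum>p\<in>{t..a}. ?f p)"
    by (rule sum.mono_neutral_right) auto
  also have "\<dots> = (\<Sum>p\<in>(+) t ` {..A}. ?f p)"
    using assms(1) by (simp add: defs atMost_atLeast0)
  also have "\<dots> = (\<Sum>j\<le>A. ?f (t + j))"
    by (subst sum.reindex) (auto simp: inj_on_def)
  also have "\<dots> = (\<Sum>j\<le>A. gbin a t / (qfact n * qfact (N - n)) *
      (hp 1 (v * d) (N - n) * (sears_coeff A n N j * saal_prod u v C d A n j / hp 1 (C * d) (N - j))))"
  proof (rule sum.cong[OF refl])
    fix j assume "j \<in> {..A}"
    then have j: "j \<le> A" by simp
    show "?f (t + j) = gbin a t / (qfact n * qfact (N - n)) *
      (hp 1 (v * d) (N - n) * (sears_coeff A n N j * saal_prod u v C d A n j / hp 1 (C * d) (N - j)))"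
    proof (cases "j \<le> n")
      case True
      have e: "a - (t + j) = A - j" "k - (t + j) = n - j" "A - j + P = N - j"
        using j True by (auto simp: defs)
      have le: "t + j \<le> k" using True assms(2) by (simp add: defs)
      have "N - j - (n - j) = N - n" "n - j \<le> N - j"
        using j True assms(1-3) by (auto simp: defs)
      then have "gbin A j * gbin (N - j) (n - j) = sears_coeff A n N j / (qfact n * qfact (N - n))"
        using j True unfolding gbin_def sears_coeff_def by simp
      then have g: "gbin a (t + j) * gbin (t + j) t * gbin (N - j) (n - j)
          = gbin a t * (sears_coeff A n N j / (qfact n * qfact (N - n)))"
        by (simp only: gbin_mult_gbin mult.assoc defs(1))
      have "?f (t + j) = gbin a (t + j) * gbin (t + j) t * gbin (N - j) (n - j)
          * (hp u v j * hp 1 (u * d) (A - j) * hp v C (n - j) * hp 1 (v * d) (N - n) / hp 1 (C * d) (N - j))"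
        unfolding col_weight_def if_P[OF le] e Nn by simp
      also have "\<dots> = gbin a t / (qfact n * qfact (N - n)) *
        (hp 1 (v * d) (N - n) * (sears_coeff A n N j * saal_prod u v C d A n j / hp 1 (C * d) (N - j)))"
        unfolding g saal_prod_def by simp
      finally show ?thesis .
    next
      case False
      then have "\<not> t + j \<le> k" using assms(2) by (simp add: defs)
      with False show ?thesis
        by (simp add: col_weight_def sears_coeff_def)
    qed
  qed
  finally show ?thesis
    by (simp add: sears_sum_def sum_distrib_left)
qed

lemma col_weight_right_sum:
  assumes "t \<le> a" "t \<le> k" "k \<le> a + P" and defs: "A = a - t" "n = k - t" "N = A + P"
  shows "(\<Sum>T\<le>P. col_weight v u C d a k t T * hp v C T * gbin P T * hp u v (P - T))
       = gbin a t / (qfact n * qfact (N - n))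
         * (hp 1 (v * d) A * hp u C n * sears_sum u v C d N (N - n) P)"
proof -
  let ?f = "\<lambda>T. col_weight v u C d a k t T * hp v C T * gbin P T * hp u v (P - T)"
  have "(\<Sum>T\<le>P. ?f T) = (\<Sum>J\<le>P. ?f (P - J))"
    by (rule sum.reindex_bij_witness[of _ "\<lambda>J. P - J" "\<lambda>J. P - J"]) auto
  also have "\<dots> = (\<Sum>J\<le>P. gbin a t / (qfact n * qfact (N - n)) *
      (hp 1 (v * d) A * hp u C n * (sears_coeff (N - n) P N J * saal_prod u v C d (N - n) P J / hp 1 (C * d) (N - J))))"
  proof (rule sum.cong[OF refl])
    fix J assume "J \<in> {..P}"
    then have J: "J \<le> P" by simp
    have e: "A + (P - J) = N - J" "a + (P - J) - k = N - n - J" "P - (P - J) = J"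
      using J assms(1,2) by (auto simp: defs)
    have "gbin P J * gbin (N - J) n = sears_coeff (N - n) P N J / (qfact n * qfact (N - n))"
    proof (cases "J \<le> N - n")
      case True
      have "n \<le> N" using assms(1-3) by (auto simp: defs)
      with True have "n \<le> N - J" "N - J - n = N - n - J" by linarith+
      then show ?thesis
        using J True unfolding gbin_def sears_coeff_def by simp
    next
      case False
      moreover have "J \<le> N" using J by (simp add: defs)
      ultimately have "N - J < n" by linarith
      with False show ?thesis
        by (simp add: sears_coeff_def)
    qed
    then have g: "gbin a t * (gbin P J * gbin (N - J) n)
       = gbin a t * (sears_coeff (N - n) P N J / (qfact n * qfact (N - n)))"
      by (rule arg_cong)
    have "?f (P - J) = gbin a t * (gbin P J * gbin (N - J) n)
        * (hp 1 (v * d) A * hp u C n * (hp 1 (u * d) (N - n - J) * hp u v J * hp v C (P - J)) / hp 1 (C * d) (N - J))"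
      unfolding col_weight_def if_P[OF assms(2)] gbin_commute[OF J] defs(1,2)[symmetric] e
      by simp
    then show "?f (P - J) = gbin a t / (qfact n * qfact (N - n)) *
      (hp 1 (v * d) A * hp u C n * (sears_coeff (N - n) P N J * saal_prod u v C d (N - n) P J / hp 1 (C * d) (N - J)))"
      unfolding g saal_prod_def by simp
  qed
  finally show ?thesis
    unfolding sears_sum_commuted_range sum_distrib_left .
qed

text \<open>
  The kernel \<open>gbin p t * hp u v (p - t)\<close> passes through a column.  Both sides are multiples of the sums
  in \<open>sears_transformation\<close>: the left side of the one with \<open>N - n, P\<close> and the right side of the one with
  \<open>A, n\<close>, where \<open>A = a - t\<close>, \<open>n = k - t\<close> and \<open>N = A + P\<close>.
  If one of these differences would be negative, or \<open>n > N\<close>, both sides vanish.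
\<close>

lemma column_exchange:
  assumes Cd: "norm (C * d) < 1"
  shows "(\<Sum>T\<le>P. col_weight v u C d a k t T * hp v C T * gbin P T * hp u v (P - T))
       = hp u C P * (\<Sum>p\<le>a. gbin p t * hp u v (p - t) * col_weight u v C d a k p P)"
proof (cases "t \<le> a \<and> t \<le> k \<and> k \<le> a + P")
  case True
  then have t: "t \<le> a" "t \<le> k" "k \<le> a + P" by auto
  define A n N where "A = a - t" and "n = k - t" and "N = A + P"
  have "A \<le> N" "n \<le> N" "N - A = P"
    using t by (auto simp: A_def n_def N_def)
  then have "hp 1 (v * d) (N - n) * hp u C P * sears_sum u v C d N A n
       = hp 1 (v * d) A * hp u C n * sears_sum u v C d N (N - n) P"
    using sears_transformation[OF Cd, of A N n v u] by simp
  then show ?thesis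
    unfolding col_weight_left_sum[OF t A_def n_def N_def] col_weight_right_sum[OF t A_def n_def N_def]
    by (metis mult.assoc mult.left_commute)
next
  case False
  have "col_weight v u C d a k t T * hp v C T * gbin P T * hp u v (P - T) = 0" if "T \<le> P" for T
  proof (cases "t \<le> a \<and> t \<le> k")
    case True
    with False that have "a - t + T < k - t" by auto
    then show ?thesis by (simp add: col_weight_def)
  qed (auto simp: col_weight_def)
  moreover have "gbin p t * hp u v (p - t) * col_weight u v C d a k p P = 0" if "p \<le> a" for p
  proof (cases "t \<le> p \<and> p \<le> k")
    case True
    with False that have "a - p + P < k - p" by auto
    then show ?thesis by (simp add: col_weight_def)
  qed (auto simp: col_weight_def)
  ultimately show ?thesis
    by (simp del: mult_eq_0_iff)
qed

text \<open>
  The sum of the weights of the first \<open>n\<close> columns over all ways to perform the two steps from \<open>la\<close> to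
  \<open>\<nu>\<close>, the one with \<open>u\<close> first, if \<open>p\<close> particles leave the column with index 0 in the first step.  The factor
  \<open>hp u (c 0) p\<close> is left out as in \<open>col_weight\<close>; the recursion supplies the one that belongs to the
  next column.
\<close>

primrec two_row :: "nat \<Rightarrow> complex \<Rightarrow> complex \<Rightarrow> (nat \<Rightarrow> complex) \<Rightarrow> (nat \<Rightarrow> complex)
    \<Rightarrow> (nat \<Rightarrow> nat) \<Rightarrow> (nat \<Rightarrow> nat) \<Rightarrow> nat \<Rightarrow> complex" where
  "two_row 0 u v c d la \<nu> p = (if p = 0 then 1 else 0)"
| "two_row (Suc n) u v c d la \<nu> p =
     (\<Sum>P\<le>la 1. col_weight u v (c 1) (d 0) (la 0 - la 1) (la 0 - \<nu> 0) p P
                  / hp 1 (c 0 * d 0) (la 0 - la 1) * hp u (c 1) P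
                  * two_row n u v (c \<circ> Suc) (d \<circ> Suc) (la \<circ> Suc) (\<nu> \<circ> Suc) P)"

lemma two_row_exchange:
  assumes "\<And>i. norm (c (Suc i) * d i) < 1"
  shows "two_row n v u c d la \<nu> t
       = (\<Sum>p\<le>la 0. gbin p t * hp u v (p - t) * two_row n u v c d la \<nu> p)"
  using assms
proof (induction n arbitrary: c d la \<nu> t)
  case 0
  have "(\<Sum>p\<le>la 0. gbin p t * hp u v (p - t) * two_row 0 u v c d la \<nu> p)
      = (\<Sum>p\<in>{0}. gbin p t * hp u v (p - t) * two_row 0 u v c d la \<nu> p)"
    by (rule sum.mono_neutral_right) auto
  then show ?case by (simp add: gbin_def)
next
  case (Suc n)
  let ?C = "c 1" and ?a = "la 0 - la 1" and ?k = "la 0 - \<nu> 0"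
  let ?h = "hp 1 (c 0 * d 0) ?a"
  let ?W = "\<lambda>u v. two_row n u v (c \<circ> Suc) (d \<circ> Suc) (la \<circ> Suc) (\<nu> \<circ> Suc)"
  let ?L = "\<lambda>u v p P. col_weight u v ?C (d 0) ?a ?k p P"
  have IH: "?W v u T = (\<Sum>P\<le>la 1. gbin P T * hp u v (P - T) * ?W u v P)" for T
  proof -
    have "norm ((c \<circ> Suc) (Suc i) * (d \<circ> Suc) i) < 1" for i
      using Suc.prems[of "Suc i"] by simp
    from Suc.IH[of "c \<circ> Suc" "d \<circ> Suc", OF this]
    show ?thesis by (simp add: comp_def)
  qed
  have Cd: "norm (?C * d 0) < 1"
    using Suc.prems[of 0] by simp
  have "two_row (Suc n) v u c d la \<nu> t
      = (\<Sum>T\<le>la 1. \<Sum>P\<le>la 1. ?L v u t T / ?h * hp v ?C T * (gbin P T * hp u v (P - T) * ?W u v P))"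
    by (simp add: IH sum_distrib_left)
  also have "\<dots> = (\<Sum>P\<le>la 1. \<Sum>T\<le>la 1. ?L v u t T / ?h * hp v ?C T * (gbin P T * hp u v (P - T) * ?W u v P))"
    by (rule sum.swap)
  also have "\<dots> = (\<Sum>P\<le>la 1. (\<Sum>T\<le>P. ?L v u t T * hp v ?C T * gbin P T * hp u v (P - T)) / ?h * ?W u v P)"
  proof (rule sum.cong[OF refl])
    fix P assume P: "P \<in> {..la 1}"
    have "(\<Sum>T\<le>la 1. ?L v u t T / ?h * hp v ?C T * (gbin P T * hp u v (P - T) * ?W u v P))
        = (\<Sum>T\<le>P. ?L v u t T / ?h * hp v ?C T * (gbin P T * hp u v (P - T) * ?W u v P))"
      using P by (intro sum.mono_neutral_right) auto
    also have "\<dots> = (\<Sum>T\<le>P. ?L v u t T * hp v ?C T * gbin P T * hp u v (P - T)) / ?h * ?W u v P"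
      unfolding sum_divide_distrib sum_distrib_right by (intro sum.cong refl) simp
    finally show "(\<Sum>T\<le>la 1. ?L v u t T / ?h * hp v ?C T * (gbin P T * hp u v (P - T) * ?W u v P))
        = (\<Sum>T\<le>P. ?L v u t T * hp v ?C T * gbin P T * hp u v (P - T)) / ?h * ?W u v P" .
  qed
  also have "\<dots> = (\<Sum>P\<le>la 1. (hp u ?C P * (\<Sum>p\<le>?a. gbin p t * hp u v (p - t) * ?L u v p P)) / ?h * ?W u v P)"
    unfolding column_exchange[OF Cd] ..
  also have "\<dots> = (\<Sum>P\<le>la 1. \<Sum>p\<le>?a. gbin p t * hp u v (p - t) * (?L u v p P / ?h * hp u ?C P * ?W u v P))"
    by (intro sum.cong refl) (simp add: sum_divide_distrib sum_distrib_right sum_distrib_left mult_ac)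
  also have "\<dots> = (\<Sum>p\<le>?a. gbin p t * hp u v (p - t) * two_row (Suc n) u v c d la \<nu> p)"
    by (subst sum.swap) (simp add: sum_distrib_left)
  also have "\<dots> = (\<Sum>p\<le>la 0. gbin p t * hp u v (p - t) * two_row (Suc n) u v c d la \<nu> p)"
  proof (rule sum.mono_neutral_left)
    show "\<forall>p\<in>{..la 0} - {..?a}. gbin p t * hp u v (p - t) * two_row (Suc n) u v c d la \<nu> p = 0"
      by (auto simp: col_weight_def intro!: sum.neutral)
  qed auto
  finally show ?case .
qed

text \<open>
  At the left end the kernel of \<open>two_row_exchange\<close> meets the weight \<open>hp v C t\<close> that was left out, and the
  sum over \<open>t\<close> is the \<open>q\<close>-binomial theorem.
\<close>

lemma two_row_symmetric:
  assumes "\<And>i. norm (c (Suc i) * d i) < 1"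
  shows "(\<Sum>p\<le>la 0. hp v C p * two_row n v u c d la \<nu> p)
       = (\<Sum>p\<le>la 0. hp u C p * two_row n u v c d la \<nu> p)"
proof -
  have exchange: "two_row n v u c d la \<nu> t
       = (\<Sum>p\<le>la 0. gbin p t * hp u v (p - t) * two_row n u v c d la \<nu> p)" for t
    by (rule two_row_exchange) (rule assms)
  have "(\<Sum>t\<le>la 0. hp v C t * two_row n v u c d la \<nu> t)
      = (\<Sum>t\<le>la 0. \<Sum>p\<le>la 0. hp v C t * (gbin p t * hp u v (p - t)) * two_row n u v c d la \<nu> p)"
    by (simp only: exchange sum_distrib_left mult.assoc)
  also have "\<dots> = (\<Sum>p\<le>la 0. (\<Sum>t\<le>la 0. hp v C t * (gbin p t * hp u v (p - t))) * two_row n u v c d la \<nu> p)"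
    by (subst sum.swap) (simp add: sum_distrib_right)
  also have "\<dots> = (\<Sum>p\<le>la 0. hp u C p * two_row n u v c d la \<nu> p)"
  proof (rule sum.cong[OF refl])
    fix p assume p: "p \<in> {..la 0}"
    have "(\<Sum>t\<le>la 0. hp v C t * (gbin p t * hp u v (p - t))) = (\<Sum>t\<le>p. hp v C t * (gbin p t * hp u v (p - t)))"
      using p by (intro sum.mono_neutral_right) auto
    also have "\<dots> = (\<Sum>i\<le>p. gbin p i * hp u v i * hp v C (p - i))"
      by (rule sum.reindex_bij_witness[of _ "\<lambda>i. p - i" "\<lambda>i. p - i"]) (auto simp: gbin_commute)
    also have "\<dots> = hp u C p"
      by (rule q_binomial_convolution[symmetric])
    finally show "(\<Sum>t\<le>la 0. hp v C t * (gbin p t * hp u v (p - t))) * two_row n u v c d la \<nu> p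
        = hp u C p * two_row n u v c d la \<nu> p"
      by simp
  qed
  finally show ?thesis .
qed

text \<open>
  The factor of \<open>skewF\<close> for one column.  It vanishes unless its own part of the interlacing condition
  holds, so that the product over all columns takes care of that condition.
\<close>

definition skew_col :: "complex \<Rightarrow> complex \<Rightarrow> complex \<Rightarrow> nat \<Rightarrow> nat \<Rightarrow> nat \<Rightarrow> complex" where
  "skew_col x c d l m l' =
     (if l' \<le> m \<and> m \<le> l
      then gbin (l - l') (l - m) * hp x c (l - m) * hp 1 (x * d) (m - l') / hp 1 (c * d) (l - l')
      else 0)"

lemma skew_col_zero [simp]: "skew_col x c d 0 0 0 = 1"
  by (simp add: skew_col_def)

lemma poly_skewF_eq_prod:
  assumes "\<And>i. n \<le> i \<Longrightarrow> la i = 0" "\<And>i. n \<le> i \<Longrightarrow> \<mu> i = 0"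
  shows "poly (skewF q n c d la \<mu>) x = (\<Prod>r<n. skew_col x (c r) (d r) (la r) (\<mu> r) (la (Suc r)))"
proof (cases "\<mu> \<preceq> la")
  case True
  have "skew_col x (c r) (d r) (la r) (\<mu> r) (la (Suc r)) =
     qfact (la r - la (Suc r)) / (qfact (la r - \<mu> r) * qfact (\<mu> r - la (Suc r)) *
                       hp 1 (c r * d r) (la r - la (Suc r)))
       * (hp x (c r) (la r - \<mu> r) * hp 1 (x * d r) (\<mu> r - la (Suc r)))" for r
  proof -
    have "\<mu> r \<le> la r" "la (Suc r) \<le> \<mu> r"
      using True by (auto simp: interlaces_def)
    then show ?thesis by (simp add: skew_col_def gbin_def)
  qed
  moreover have "poly (\<Prod>i<k. [:- (e * q ^ i), 1:]) x = hp x e k" for k e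
    by (simp add: poly_prod hpoch_def)
  ultimately show ?thesis
    using True by (simp add: skewF_def poly_prod poly_qpoch qpoch_eq_hpoch)
next
  case False
  then obtain r where r: "\<not> (\<mu> r \<le> la r \<and> la (Suc r) \<le> \<mu> r)"
    by (auto simp: interlaces_def)
  then have "r < n" using assms by (metis not_le_imp_less le_Suc_eq order_refl zero_le)
  with r False show ?thesis
    by (auto simp: skewF_def skew_col_def intro!: prod_zero[symmetric])
qed

text \<open>
  Interlacing with \<open>la\<close> already forces \<open>\<mu>\<close> to be decreasing, so that the first part and the remaining
  parts of \<open>\<mu>\<close> vary independently.
\<close>

lemma sum_interlacing_Suc:
  "(\<Sum>\<mu> | \<mu> \<in> partitions (Suc n) \<and> \<mu> \<preceq> la. g \<mu>)
     = (\<Sum>m\<in>{la 1..la 0}. \<Sum>\<mu> | \<mu> \<in> partitions n \<and> \<mu> \<preceq> la \<circ> Suc. g (case_nat m \<mu>))"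
proof -
  let ?S = "{\<mu> \<in> partitions n. \<mu> \<preceq> la \<circ> Suc}"
  have "(\<Sum>\<mu> | \<mu> \<in> partitions (Suc n) \<and> \<mu> \<preceq> la. g \<mu>) = (\<Sum>(m, \<mu>)\<in>{la 1..la 0} \<times> ?S. g (case_nat m \<mu>))"
  proof (rule sum.reindex_bij_witness[of _ "\<lambda>(m, \<mu>). case_nat m \<mu>" "\<lambda>\<mu>. (\<mu> 0, \<mu> \<circ> Suc)"])
    fix \<mu> assume \<mu>: "\<mu> \<in> {\<mu> \<in> partitions (Suc n). \<mu> \<preceq> la}"
    show eq: "(case (\<mu> 0, \<mu> \<circ> Suc) of (m, \<mu>) \<Rightarrow> case_nat m \<mu>) = \<mu>"
      by (auto simp: fun_eq_iff split: nat.splits)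
    then show "(case (\<mu> 0, \<mu> \<circ> Suc) of (m, \<mu>) \<Rightarrow> g (case_nat m \<mu>)) = g \<mu>"
      by simp
    show "(\<mu> 0, \<mu> \<circ> Suc) \<in> {la 1..la 0} \<times> ?S"
      using \<mu> by (auto simp: partitions_def interlaces_def antimono_def)
  next
    fix m\<mu> assume m\<mu>: "m\<mu> \<in> {la 1..la 0} \<times> ?S"
    obtain m \<mu> where [simp]: "m\<mu> = (m, \<mu>)" by (cases m\<mu>)
    show "((case m\<mu> of (m, \<mu>) \<Rightarrow> case_nat m \<mu>) 0, (case m\<mu> of (m, \<mu>) \<Rightarrow> case_nat m \<mu>) \<circ> Suc) = m\<mu>"
      by (simp add: comp_def)
    have il: "case_nat m \<mu> \<preceq> la"
      using m\<mu> by (auto simp: interlaces_def split: nat.splits)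
    then have "antimono (case_nat m \<mu>)"
      unfolding interlaces_def by (intro antimono_iff_le_Suc[THEN iffD2] allI) (metis order_trans)
    then show "(case m\<mu> of (m, \<mu>) \<Rightarrow> case_nat m \<mu>) \<in> {\<mu> \<in> partitions (Suc n). \<mu> \<preceq> la}"
      using il m\<mu> by (auto simp: partitions_def split: nat.splits)
  qed
  then show ?thesis
    by (simp add: sum.cartesian_product)
qed

lemma skew_col_product:
  assumes "la1 \<le> la0" "p \<le> la0 - la1" "P \<le> la1" "\<nu>0 \<le> la0"
  shows "skew_col u c0 d la0 (la0 - p) la1 * skew_col v c1 d (la0 - p) \<nu>0 (la1 - P)
       = hp u c0 p * col_weight u v c1 d (la0 - la1) (la0 - \<nu>0) p P / hp 1 (c0 * d) (la0 - la1)"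
proof -
  let ?a = "la0 - la1" and ?k = "la0 - \<nu>0"
  have 1: "skew_col u c0 d la0 (la0 - p) la1
      = gbin ?a p * hp u c0 p * hp 1 (u * d) (?a - p) / hp 1 (c0 * d) ?a"
  proof -
    have "la1 \<le> la0 - p" "la0 - p \<le> la0" "la0 - (la0 - p) = p" "la0 - p - la1 = ?a - p"
      using assms by auto
    then show ?thesis by (simp add: skew_col_def)
  qed
  consider "?k < p" | "?a + P < ?k" "p \<le> ?k" | "p \<le> ?k" "?k \<le> ?a + P" by linarith
  then show ?thesis
  proof cases
    case 1
    then have "\<not> \<nu>0 \<le> la0 - p" using assms by auto
    with 1 show ?thesis by (simp add: skew_col_def col_weight_def)
  next
    case 2
    then have "\<not> la1 - P \<le> \<nu>0" "?a - p + P < ?k - p" using assms by auto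
    then show ?thesis by (simp add: skew_col_def col_weight_def)
  next
    case 3
    then have le: "la1 - P \<le> \<nu>0 \<and> \<nu>0 \<le> la0 - p" and e: "la0 - p - (la1 - P) = ?a - p + P"
      "la0 - p - \<nu>0 = ?k - p" "\<nu>0 - (la1 - P) = ?a + P - ?k"
      using assms by auto
    have "skew_col v c1 d (la0 - p) \<nu>0 (la1 - P)
        = gbin (?a - p + P) (?k - p) * hp v c1 (?k - p) * hp 1 (v * d) (?a + P - ?k) / hp 1 (c1 * d) (?a - p + P)"
      unfolding skew_col_def if_P[OF le] e ..
    with 3 show ?thesis
      unfolding 1 col_weight_def by (simp add: mult_ac)
  qed
qed

text \<open>
  The column with index 0 sees the next one only through \<open>\<mu> 1\<close>.  The weight \<open>h\<close> of the first jump is arbitrary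
  because in the induction this role is played by the factors of the preceding column.
\<close>

lemma sum_two_skew_rows:
  assumes "la \<in> partitions n" "\<And>i. \<nu> i \<le> la i"
  shows "(\<Sum>\<mu> | \<mu> \<in> partitions n \<and> \<mu> \<preceq> la. h (la 0 - \<mu> 0) *
            (\<Prod>r<n. skew_col u (c r) (d r) (la r) (\<mu> r) (la (Suc r)) *
                    skew_col v (c (Suc r)) (d r) (\<mu> r) (\<nu> r) (\<mu> (Suc r))))
       = (\<Sum>p\<le>la 0. h p * (hp u (c 0) p * two_row n u v c d la \<nu> p))"
  using assms
proof (induction n arbitrary: c d la \<nu> h)
  case 0
  then have la: "la = (\<lambda>_. 0)"
    by (auto simp: partitions_def)
  have "{\<mu> \<in> partitions 0. \<mu> \<preceq> la} = {\<lambda>_. 0}"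
    unfolding la by (auto simp: partitions_def interlaces_def antimono_def)
  then show ?case by (simp add: la)
next
  case (Suc n)
  let ?a = "la 0 - la 1" and ?k = "la 0 - \<nu> 0"
  let ?S = "{\<mu> \<in> partitions n. \<mu> \<preceq> la \<circ> Suc}"
  let ?w = "\<lambda>c d la \<nu> \<mu> r. skew_col u (c r) (d r) (la r) (\<mu> r) (la (Suc r)) *
                    skew_col v (c (Suc r)) (d r) (\<mu> r) (\<nu> r) (\<mu> (Suc r))"
  let ?T = "two_row n u v (c \<circ> Suc) (d \<circ> Suc) (la \<circ> Suc) (\<nu> \<circ> Suc)"
  have la10: "la 1 \<le> la 0"
    using Suc.prems(1) by (simp add: partitions_def antimono_def)
  have la': "la \<circ> Suc \<in> partitions n" and \<nu>': "\<And>i. (\<nu> \<circ> Suc) i \<le> (la \<circ> Suc) i"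
    using Suc.prems by (auto simp: partitions_def antimono_def)
  have inner: "(\<Sum>\<mu>\<in>?S. h (la 0 - m) * (\<Prod>r<Suc n. ?w c d la \<nu> (case_nat m \<mu>) r))
      = h (la 0 - m) * skew_col u (c 0) (d 0) (la 0) m (la 1) *
        (\<Sum>P\<le>la 1. skew_col v (c 1) (d 0) m (\<nu> 0) (la 1 - P) * (hp u (c 1) P * ?T P))" for m
  proof -
    have "(\<Sum>\<mu>\<in>?S. h (la 0 - m) * (\<Prod>r<Suc n. ?w c d la \<nu> (case_nat m \<mu>) r))
       = (\<Sum>\<mu>\<in>?S. h (la 0 - m) * skew_col u (c 0) (d 0) (la 0) m (la 1) *
           (skew_col v (c 1) (d 0) m (\<nu> 0) (la 1 - ((la \<circ> Suc) 0 - \<mu> 0)) *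
             (\<Prod>r<n. ?w (c \<circ> Suc) (d \<circ> Suc) (la \<circ> Suc) (\<nu> \<circ> Suc) \<mu> r)))"
    proof (rule sum.cong[OF refl])
      fix \<mu> assume "\<mu> \<in> ?S"
      then have "\<mu> 0 \<le> la 1" by (auto simp: interlaces_def)
      then show "h (la 0 - m) * (\<Prod>r<Suc n. ?w c d la \<nu> (case_nat m \<mu>) r)
         = h (la 0 - m) * skew_col u (c 0) (d 0) (la 0) m (la 1) *
           (skew_col v (c 1) (d 0) m (\<nu> 0) (la 1 - ((la \<circ> Suc) 0 - \<mu> 0)) *
             (\<Prod>r<n. ?w (c \<circ> Suc) (d \<circ> Suc) (la \<circ> Suc) (\<nu> \<circ> Suc) \<mu> r))"
        unfolding prod.lessThan_Suc_shift by simp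
    qed
    also have "\<dots> = h (la 0 - m) * skew_col u (c 0) (d 0) (la 0) m (la 1) *
        (\<Sum>P\<le>la 1. skew_col v (c 1) (d 0) m (\<nu> 0) (la 1 - P) * (hp u (c 1) P * ?T P))"
      unfolding sum_distrib_left[symmetric]
      using Suc.IH[OF la' \<nu>', of "\<lambda>P. skew_col v (c 1) (d 0) m (\<nu> 0) (la 1 - P)" "c \<circ> Suc" "d \<circ> Suc"]
      by (simp add: comp_def)
    finally show ?thesis .
  qed
  have "(\<Sum>\<mu> | \<mu> \<in> partitions (Suc n) \<and> \<mu> \<preceq> la. h (la 0 - \<mu> 0) * (\<Prod>r<Suc n. ?w c d la \<nu> \<mu> r))
      = (\<Sum>m\<in>{la 1..la 0}. h (la 0 - m) * skew_col u (c 0) (d 0) (la 0) m (la 1) *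
        (\<Sum>P\<le>la 1. skew_col v (c 1) (d 0) m (\<nu> 0) (la 1 - P) * (hp u (c 1) P * ?T P)))"
    unfolding sum_interlacing_Suc inner[symmetric] by simp
  also have "\<dots> = (\<Sum>p\<le>?a. h p * skew_col u (c 0) (d 0) (la 0) (la 0 - p) (la 1) *
        (\<Sum>P\<le>la 1. skew_col v (c 1) (d 0) (la 0 - p) (\<nu> 0) (la 1 - P) * (hp u (c 1) P * ?T P)))"
    using la10 by (intro sum.reindex_bij_witness[of _ "\<lambda>p. la 0 - p" "\<lambda>m. la 0 - m"]) auto
  also have "\<dots> = (\<Sum>p\<le>?a. h p * (hp u (c 0) p * two_row (Suc n) u v c d la \<nu> p))"
  proof (rule sum.cong[OF refl])
    fix p assume "p \<in> {..?a}"
    then have "skew_col u (c 0) (d 0) (la 0) (la 0 - p) (la 1) * skew_col v (c 1) (d 0) (la 0 - p) (\<nu> 0) (la 1 - P)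
       = hp u (c 0) p * col_weight u v (c 1) (d 0) ?a ?k p P / hp 1 (c 0 * d 0) ?a" if "P \<le> la 1" for P
      using skew_col_product[OF la10 _ that] Suc.prems(2) by simp
    then have "(\<Sum>P\<le>la 1. (skew_col u (c 0) (d 0) (la 0) (la 0 - p) (la 1) *
          skew_col v (c 1) (d 0) (la 0 - p) (\<nu> 0) (la 1 - P)) * (hp u (c 1) P * ?T P))
        = (\<Sum>P\<le>la 1. (hp u (c 0) p * col_weight u v (c 1) (d 0) ?a ?k p P / hp 1 (c 0 * d 0) ?a)
             * (hp u (c 1) P * ?T P))"
      by (intro sum.cong refl) simp
    then have "skew_col u (c 0) (d 0) (la 0) (la 0 - p) (la 1) *
        (\<Sum>P\<le>la 1. skew_col v (c 1) (d 0) (la 0 - p) (\<nu> 0) (la 1 - P) * (hp u (c 1) P * ?T P))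
        = hp u (c 0) p * two_row (Suc n) u v c d la \<nu> p"
      by (simp add: sum_distrib_left mult.assoc)
    then show "h p * skew_col u (c 0) (d 0) (la 0) (la 0 - p) (la 1) *
        (\<Sum>P\<le>la 1. skew_col v (c 1) (d 0) (la 0 - p) (\<nu> 0) (la 1 - P) * (hp u (c 1) P * ?T P))
        = h p * (hp u (c 0) p * two_row (Suc n) u v c d la \<nu> p)"
      unfolding mult.assoc by (rule arg_cong)
  qed
  also have "\<dots> = (\<Sum>p\<le>la 0. h p * (hp u (c 0) p * two_row (Suc n) u v c d la \<nu> p))"
  proof (rule sum.mono_neutral_left)
    show "\<forall>p\<in>{..la 0} - {..?a}. h p * (hp u (c 0) p * two_row (Suc n) u v c d la \<nu> p) = 0"
      by (auto simp: col_weight_def intro!: sum.neutral)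
  qed auto
  finally show ?case .
qed

end

section \<open>Evaluation of multivariate polynomials\<close>

text \<open>
  Polynomials are compared through their values: evaluation turns the recursion for \<open>spinF\<close> into a
  recursion between functions, in which variables can be permuted and specialised freely.
\<close>

definition monom_eval :: "(nat \<Rightarrow> complex) \<Rightarrow> (nat \<Rightarrow>\<^sub>0 nat) \<Rightarrow> complex" where
  "monom_eval x m = (\<Prod>i\<in>Poly_Mapping.keys m. x i ^ Poly_Mapping.lookup m i)"

lemma monom_eval_superset:
  assumes "finite A" "Poly_Mapping.keys m \<subseteq> A"
  shows "monom_eval x m = (\<Prod>i\<in>A. x i ^ Poly_Mapping.lookup m i)"
  unfolding monom_eval_def using assms
  by (intro prod.mono_neutral_left) (auto simp: in_keys_iff)

lemma monom_eval_add: "monom_eval x (m + m') = monom_eval x m * monom_eval x m'"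
proof -
  let ?A = "Poly_Mapping.keys m \<union> Poly_Mapping.keys m'"
  have "Poly_Mapping.keys (m + m') \<subseteq> ?A"
    by (rule Poly_Mapping.keys_add)
  then show ?thesis
    by (simp add: monom_eval_superset[of ?A] lookup_add power_add prod.distrib)
qed

definition meval :: "(nat \<Rightarrow> complex) \<Rightarrow> cmpoly \<Rightarrow> complex" where
  "meval x p = (\<Sum>m\<in>Poly_Mapping.keys p. Poly_Mapping.lookup p m * monom_eval x m)"

lemma meval_superset:
  assumes "finite A" "Poly_Mapping.keys p \<subseteq> A"
  shows "meval x p = (\<Sum>m\<in>A. Poly_Mapping.lookup p m * monom_eval x m)"
  unfolding meval_def using assms
  by (intro sum.mono_neutral_left) (auto simp: in_keys_iff)

lemma meval_add: "meval x (p + p') = meval x p + meval x p'"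
proof -
  let ?A = "Poly_Mapping.keys p \<union> Poly_Mapping.keys p'"
  have "Poly_Mapping.keys (p + p') \<subseteq> ?A"
    by (rule Poly_Mapping.keys_add)
  then show ?thesis
    by (simp add: meval_superset[of ?A] lookup_add distrib_right sum.distrib)
qed

lemma meval_0 [simp]: "meval x 0 = 0"
  by (simp add: meval_def)

lemma meval_sum: "meval x (sum f A) = (\<Sum>a\<in>A. meval x (f a))"
  by (induction A rule: infinite_finite_induct) (simp_all add: meval_add)

lemma meval_single: "meval x (Poly_Mapping.single m a) = a * monom_eval x m"
  by (cases "a = 0") (simp_all add: meval_def)

lemma poly_mapping_sum_single:
  "(\<Sum>m\<in>Poly_Mapping.keys p. Poly_Mapping.single m (Poly_Mapping.lookup p m)) = p"
  by (rule poly_mapping_eqI) (auto simp: lookup_sum lookup_single when_def in_keys_iff)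

lemma meval_mult: "meval x (p * p') = meval x p * meval x p'"
proof -
  have "p * p' = (\<Sum>m\<in>Poly_Mapping.keys p. \<Sum>m'\<in>Poly_Mapping.keys p'.
      Poly_Mapping.single (m + m') (Poly_Mapping.lookup p m * Poly_Mapping.lookup p' m'))"
    unfolding mult_single[symmetric] sum_product[symmetric] poly_mapping_sum_single ..
  then have "meval x (p * p') = (\<Sum>m\<in>Poly_Mapping.keys p. \<Sum>m'\<in>Poly_Mapping.keys p'.
      (Poly_Mapping.lookup p m * monom_eval x m) * (Poly_Mapping.lookup p' m' * monom_eval x m'))"
    by (simp add: meval_sum meval_single monom_eval_add mult_ac)
  then show ?thesis
    by (simp add: meval_def sum_product)
qed

lemma meval_mconst [simp]: "meval x (mconst a) = a"
  by (simp add: mconst_def meval_single monom_eval_def)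

lemma meval_mvar [simp]: "meval x (mvar i) = x i"
  by (simp add: mvar_def meval_single monom_eval_def)

lemma meval_1 [simp]: "meval x 1 = 1"
  using meval_mconst[of x 1] by (simp add: mconst_def)

lemma meval_diff: "meval x (p - p') = meval x p - meval x p'"
  using meval_add[of x "p - p'" p'] by simp

lemma meval_prod: "meval x (prod f A) = (\<Prod>a\<in>A. meval x (f a))"
  by (induction A rule: infinite_finite_induct) (simp_all add: meval_mult)

lemma meval_mscale: "meval x (mscale a p) = a * meval x p"
  by (simp add: mscale_eq_mult meval_mult)

lemma meval_at_var: "meval x (at_var p i) = poly p (x i)"
  unfolding at_var_def
proof (induction p)
  case (pCons a p)
  have "map_poly mconst (pCons a p) = pCons (mconst a) (map_poly mconst p)"
    using pCons.hyps by (intro map_poly_pCons) (auto simp: mconst_def)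
  then show ?case using pCons by (simp add: meval_add meval_mult)
qed simp

lemma meval_cong:
  assumes "\<And>i. i \<in> vars p \<Longrightarrow> x i = y i"
  shows "meval x p = meval y p"
proof -
  have "monom_eval x m = monom_eval y m" if "m \<in> Poly_Mapping.keys p" for m
  proof -
    have "x i = y i" if "i \<in> Poly_Mapping.keys m" for i
      using assms that \<open>m \<in> Poly_Mapping.keys p\<close> by (auto simp: vars_def)
    then show ?thesis by (simp add: monom_eval_def)
  qed
  then show ?thesis by (simp add: meval_def)
qed

text \<open>
  Induction on the number of variables: with all other variables fixed, the sum is a polynomial in the last
  one, and its coefficients vanish.
\<close>

lemma exponent_functions_independent:
  fixes K :: "(nat \<Rightarrow> nat) set" and a :: "(nat \<Rightarrow> nat) \<Rightarrow> complex"
  assumes "finite K" "\<forall>e\<in>K. \<forall>e'\<in>K. (\<forall>i<n. e i = e' i) \<longrightarrow> e = e'"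
    and "\<forall>x. (\<Sum>e\<in>K. a e * (\<Prod>i<n. x i ^ e i)) = 0" and "e \<in> K"
  shows "a e = 0"
  using assms
proof (induction n arbitrary: K e)
  case 0
  then have "K = {e}" by auto
  with 0(3) show ?case by simp
next
  case (Suc n)
  let ?K = "\<lambda>k. {e \<in> K. e n = k}"
  have "(\<Sum>e'\<in>?K (e n). a e' * (\<Prod>i<n. x i ^ e' i)) = 0" for x
  proof -
    define P where "P = (\<Sum>e\<in>K. monom (a e * (\<Prod>i<n. x i ^ e i)) (e n))"
    have "poly P t = 0" for t
    proof -
      have "(\<Prod>i<n. x i ^ e i) = (\<Prod>i<n. (x(n := t)) i ^ e i)" for e :: "nat \<Rightarrow> nat"
        by (intro prod.cong) auto
      then have "poly P t = (\<Sum>e\<in>K. a e * (\<Prod>i<Suc n. (x(n := t)) i ^ e i))"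
        by (simp add: P_def poly_sum poly_monom mult.assoc)
      then show ?thesis using Suc.prems(3) by (simp only:)
    qed
    then have "P = 0" by (simp add: poly_all_0_iff_0[symmetric])
    then have "coeff P (e n) = 0" by simp
    then have "(\<Sum>e'\<in>K. if e' n = e n then a e' * (\<Prod>i<n. x i ^ e' i) else 0) = 0"
      by (simp add: P_def coeff_sum coeff_monom)
    then show ?thesis
      using Suc.prems(1) by (simp add: sum.If_cases Int_def)
  qed
  then show ?case
    using Suc.prems by (intro Suc.IH[of "?K (e n)"]) (auto simp: less_Suc_eq)
qed

lemma meval_eq_0_imp:
  assumes "\<And>x. meval x p = 0"
  shows "p = 0"
proof (rule ccontr)
  assume "p \<noteq> 0"
  then obtain m where m: "m \<in> Poly_Mapping.keys p"
    by (metis equals0I keys_eq_empty)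
  have fin: "finite (vars p)"
    by (auto simp: vars_def)
  then obtain n where n: "vars p \<subseteq> {..<n}"
    by (metis finite_nat_iff_bounded)
  let ?K = "Poly_Mapping.lookup ` Poly_Mapping.keys p"
  let ?a = "\<lambda>e. Poly_Mapping.lookup p (the_inv Poly_Mapping.lookup e)"
  have inj: "inj (Poly_Mapping.lookup :: (nat \<Rightarrow>\<^sub>0 nat) \<Rightarrow> _)"
    by (rule injI) (auto intro: poly_mapping_eqI)
  have "?a (Poly_Mapping.lookup m) = 0"
  proof (rule exponent_functions_independent[where a = ?a and K = ?K and n = n])
    show "finite ?K" by simp
    show "Poly_Mapping.lookup m \<in> ?K" using m by simp
    show "\<forall>e\<in>?K. \<forall>e'\<in>?K. (\<forall>i<n. e i = e' i) \<longrightarrow> e = e'"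
    proof (intro ballI impI ext)
      fix e e' i
      assume e: "e \<in> ?K" "e' \<in> ?K" "\<forall>i<n. e i = e' i"
      show "e i = e' i"
      proof (cases "i < n")
        case False
        have "Poly_Mapping.lookup m' i = 0" if "m' \<in> Poly_Mapping.keys p" for m'
          using n that False by (force simp: vars_def in_keys_iff)
        then show ?thesis using e by auto
      qed (use e in simp)
    qed
    show "\<forall>x. (\<Sum>e\<in>?K. ?a e * (\<Prod>i<n. x i ^ e i)) = 0"
    proof
      fix x
      have "(\<Sum>e\<in>?K. ?a e * (\<Prod>i<n. x i ^ e i))
          = (\<Sum>m\<in>Poly_Mapping.keys p. ?a (Poly_Mapping.lookup m) * (\<Prod>i<n. x i ^ Poly_Mapping.lookup m i))"
        by (rule sum.reindex_cong[of Poly_Mapping.lookup]) (auto intro: inj_on_subset[OF inj])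
      also have "\<dots> = meval x p"
        unfolding meval_def
      proof (rule sum.cong[OF refl])
        fix m assume m: "m \<in> Poly_Mapping.keys p"
        then have "Poly_Mapping.keys m \<subseteq> {..<n}" using n by (auto simp: vars_def)
        then show "?a (Poly_Mapping.lookup m) * (\<Prod>i<n. x i ^ Poly_Mapping.lookup m i)
            = Poly_Mapping.lookup p m * monom_eval x m"
          by (simp add: the_inv_f_f[OF inj] monom_eval_superset[of "{..<n}"])
      qed
      finally show "(\<Sum>e\<in>?K. ?a e * (\<Prod>i<n. x i ^ e i)) = 0"
        using assms by simp
    qed
  qed
  then show False
    using m by (simp add: the_inv_f_f[OF inj] in_keys_iff)
qed

lemma meval_eqI:
  assumes "\<And>x. meval x p = meval x p'"
  shows "p = p'"
  using meval_eq_0_imp[of "p - p'"] assms by (simp add: meval_diff)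

text \<open>
  Under \<open>permute_vars\<close> the coefficient of \<open>m\<close> is that of \<open>m \<circ> \<pi>\<close>, so the variables are substituted by
  \<open>x \<circ> \<pi>\<close> and not by its inverse.
\<close>

lemma meval_permute_vars:
  assumes "bij \<pi>"
  shows "meval x (permute_vars \<pi> p) = meval (x \<circ> \<pi>) p"
proof -
  let ?M = "Poly_Mapping.map_key \<pi> :: (nat \<Rightarrow>\<^sub>0 nat) \<Rightarrow> _"
  have inj: "inj ?M" by (rule inj_map_key[OF assms])
  have surj: "\<exists>m. ?M m = m'" for m'
  proof
    show "?M (Poly_Mapping.map_key (inv \<pi>) m') = m'"
      using assms by (intro poly_mapping_eqI)
        (simp add: map_key.rep_eq bij_is_inj bij_imp_bij_inv)
  qed
  have keys_M: "Poly_Mapping.keys (?M m) = \<pi> -` Poly_Mapping.keys m" for m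
    using assms by (auto simp: in_keys_iff map_key.rep_eq bij_is_inj)
  have monom: "monom_eval (x \<circ> \<pi>) (?M m) = monom_eval x m" for m
    unfolding monom_eval_def
    by (rule prod.reindex_bij_witness[of _ "inv \<pi>" \<pi>])
      (use assms in \<open>auto simp: keys_M map_key.rep_eq bij_is_inj bij_is_surj surj_f_inv_f\<close>)
  show ?thesis
    unfolding meval_def
  proof (rule sum.reindex_bij_witness[of _ "inv ?M" ?M])
    fix m assume "m \<in> Poly_Mapping.keys (permute_vars \<pi> p)"
    then show "?M m \<in> Poly_Mapping.keys p"
      by (simp add: in_keys_iff lookup_permute_vars[OF assms])
    show "inv ?M (?M m) = m"
      by (simp add: inj)
    show "Poly_Mapping.lookup p (?M m) * monom_eval (x \<circ> \<pi>) (?M m)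
      = Poly_Mapping.lookup (permute_vars \<pi> p) m * monom_eval x m"
      by (simp add: monom lookup_permute_vars[OF assms])
  next
    fix m assume m: "m \<in> Poly_Mapping.keys p"
    obtain m' where m': "?M m' = m" using surj by blast
    then show "?M (inv ?M m) = m" by (auto simp: inj)
    then show "inv ?M m \<in> Poly_Mapping.keys (permute_vars \<pi> p)"
      using m by (simp add: in_keys_iff lookup_permute_vars[OF assms])
  qed
qed

section \<open>Bounded degree\<close>

definition degree_box :: "nat \<Rightarrow> nat \<Rightarrow> cmpoly set" where
  "degree_box n L = {p. \<forall>m\<in>Poly_Mapping.keys p.
      Poly_Mapping.keys m \<subseteq> {..<n} \<and> (\<forall>i. Poly_Mapping.lookup m i \<le> L)}"

lemma degree_box_mono: "L \<le> L' \<Longrightarrow> p \<in> degree_box n L \<Longrightarrow> p \<in> degree_box n L'"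
  unfolding degree_box_def using le_trans by blast

lemma degree_box_0: "0 \<in> degree_box n L"
  by (simp add: degree_box_def)

lemma degree_box_1: "1 \<in> degree_box n L"
  by (simp add: degree_box_def flip: single_one)

lemma degree_box_add: "p \<in> degree_box n L \<Longrightarrow> p' \<in> degree_box n L \<Longrightarrow> p + p' \<in> degree_box n L"
  using Poly_Mapping.keys_add[of p p'] by (fastforce simp: degree_box_def)

lemma degree_box_sum:
  "(\<And>a. a \<in> A \<Longrightarrow> f a \<in> degree_box n L) \<Longrightarrow> sum f A \<in> degree_box n L"
  by (induction A rule: infinite_finite_induct) (auto simp: degree_box_0 degree_box_add)

lemma degree_box_mult_at_var:
  assumes p: "p \<in> degree_box n L" and f: "degree f \<le> L"
  shows "p * at_var f n \<in> degree_box (Suc n) L"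
proof -
  have at_var: "at_var f n = (\<Sum>k\<le>degree f. Poly_Mapping.single (Poly_Mapping.single n k) (coeff f k))"
  proof (rule meval_eqI)
    fix x
    have "monom_eval x (Poly_Mapping.single n k) = x n ^ k" for k
      by (cases "k = 0") (simp_all add: monom_eval_def)
    then show "meval x (at_var f n)
        = meval x (\<Sum>k\<le>degree f. Poly_Mapping.single (Poly_Mapping.single n k) (coeff f k))"
      by (simp add: meval_at_var meval_sum meval_single poly_altdef)
  qed
  have at_keys: "\<exists>k\<le>L. m = Poly_Mapping.single n k" if m: "m \<in> Poly_Mapping.keys (at_var f n)" for m
  proof (rule ccontr)
    assume no: "\<not> ?thesis"
    have "Poly_Mapping.single n k \<noteq> m" if "k \<le> degree f" for k
    proof
      assume "Poly_Mapping.single n k = m"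
      moreover have "k \<le> L" using that f by simp
      ultimately show False using no by blast
    qed
    then have "Poly_Mapping.lookup (at_var f n) m = 0"
      unfolding at_var lookup_sum by (intro sum.neutral) (auto simp: lookup_single when_def)
    with m show False by (simp add: in_keys_iff)
  qed
  show ?thesis
    unfolding degree_box_def
  proof (intro CollectI ballI)
    fix m assume "m \<in> Poly_Mapping.keys (p * at_var f n)"
    then obtain m1 m2 where m: "m = m1 + m2" "m1 \<in> Poly_Mapping.keys p"
      and m2: "m2 \<in> Poly_Mapping.keys (at_var f n)"
      using keys_mult[of p "at_var f n"] by blast
    obtain k where k: "k \<le> L" "m2 = Poly_Mapping.single n k"
      using at_keys[OF m2] by blast
    have m1: "Poly_Mapping.keys m1 \<subseteq> {..<n}" "\<And>i. Poly_Mapping.lookup m1 i \<le> L"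
      using p m(2) by (auto simp: degree_box_def)
    have "Poly_Mapping.keys m \<subseteq> Poly_Mapping.keys m1 \<union> Poly_Mapping.keys m2"
      unfolding m(1) by (rule Poly_Mapping.keys_add)
    then have keys: "Poly_Mapping.keys m \<subseteq> {..<Suc n}"
      using m1(1) k(2) by (auto split: if_splits)
    have "Poly_Mapping.lookup m1 n = 0"
      using m1(1) by (auto simp: in_keys_iff)
    then have "Poly_Mapping.lookup m i \<le> L" for i
      using m1(2)[of i] k by (auto simp: m(1) lookup_add lookup_single when_def)
    with keys show "Poly_Mapping.keys m \<subseteq> {..<Suc n} \<and> (\<forall>i. Poly_Mapping.lookup m i \<le> L)"
      by blast
  qed
qed

lemma vars_degree_box: "p \<in> degree_box n L \<Longrightarrow> vars p \<subseteq> {..<n}"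
  by (auto simp: degree_box_def vars_def)

lemma degree_box_exists:
  assumes "vars p \<subseteq> {..<n}"
  shows "\<exists>L. p \<in> degree_box n L"
proof -
  let ?D = "(\<lambda>(m, i). Poly_Mapping.lookup m i) ` (SIGMA m:Poly_Mapping.keys p. Poly_Mapping.keys m)"
  have "finite ?D" by auto
  then obtain L where L: "\<And>k. k \<in> ?D \<Longrightarrow> k \<le> L"
    unfolding finite_nat_set_iff_bounded_le by blast
  have "Poly_Mapping.lookup m i \<le> L" if "m \<in> Poly_Mapping.keys p" for m i
  proof (cases "i \<in> Poly_Mapping.keys m")
    case True
    then show ?thesis using that by (intro L) force
  qed (simp add: in_keys_iff)
  then show ?thesis
    using assms by (intro exI[of _ L]) (auto simp: degree_box_def vars_def)
qed

section \<open>Symmetry\<close>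

context q_in_unit_disc
begin

lemma meval_spinF_Suc:
  "meval x (spinF q (Suc n) c d la) =
     (\<Sum>\<mu> | \<mu> \<in> partitions n \<and> \<mu> \<preceq> la.
        meval x (spinF q n (\<lambda>r. c (Suc r)) d \<mu>) * poly (skewF q (Suc n) c d la \<mu>) (x n))"
  by (simp add: meval_sum meval_mult meval_at_var)

lemma skewF_cong:
  assumes "\<And>i. i < n \<Longrightarrow> c i = c' i" "\<And>i. i < n \<Longrightarrow> d i = d' i"
  shows "skewF q n c d la \<mu> = skewF q n c' d' la \<mu>"
  using assms by (simp add: skewF_def)

lemma spinF_cong:
  assumes "\<And>i. i < n \<Longrightarrow> c i = c' i" "\<And>i. i < n \<Longrightarrow> d i = d' i"
  shows "spinF q n c d la = spinF q n c' d' la"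
  using assms
proof (induction n arbitrary: c c' la)
  case (Suc n)
  have "skewF q (Suc n) c d la \<mu> = skewF q (Suc n) c' d' la \<mu>" for \<mu>
    using Suc.prems by (intro skewF_cong) auto
  moreover have "spinF q n (\<lambda>r. c (Suc r)) d \<mu> = spinF q n (\<lambda>r. c' (Suc r)) d' \<mu>" for \<mu>
    using Suc.prems by (intro Suc.IH) auto
  ultimately show ?case by simp
qed simp

text \<open>
  The column with index \<open>r\<close> contributes the degree \<open>(la r - \<mu> r) + (\<mu> r - la (Suc r))\<close>, and the sum over all columns
  telescopes.
\<close>

lemma degree_skewF: "degree (skewF q n c d la \<mu>) \<le> la 0"
proof (cases "\<mu> \<preceq> la")
  case True
  have deg_q: "degree (qpoch [:0, b:] [:q:] k) \<le> k" for b k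
  proof -
    have "degree (1 - [:0, b:] * [:q:] ^ i) \<le> 1" for i
      using degree_mult_le[of "[:0, b:]" "[:q:] ^ i"] degree_power_le[of "[:q:]" i]
        degree_pCons_le[of 0 "[:b:]"]
      by (intro degree_diff_le) simp_all
    then have "sum (degree \<circ> (\<lambda>i. 1 - [:0, b:] * [:q:] ^ i)) {..<k} \<le> (\<Sum>i<k. 1)"
      by (intro sum_mono) simp
    then show ?thesis
      using degree_prod_sum_le[of "{..<k}" "\<lambda>i. 1 - [:0, b:] * [:q:] ^ i"] by (simp add: qpoch_def)
  qed
  have deg_c: "degree (\<Prod>i<k. [:- (e * q ^ i), 1:]) \<le> k" for e k
    using degree_prod_sum_le[of "{..<k}" "\<lambda>i. [:- (e * q ^ i), 1:]"] by simp
  have step: "(\<Sum>r<k. la r - la (Suc r)) + la k = la 0" for k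
  proof (induction k)
    case (Suc k)
    have "la (Suc k) \<le> la k" using True by (auto simp: interlaces_def intro: order_trans)
    then show ?case using Suc.IH by simp
  qed simp
  have "degree (skewF q n c d la \<mu>) \<le> (\<Sum>r<n. la r - la (Suc r))"
    unfolding skewF_def if_P[OF True]
  proof (rule order_trans[OF degree_prod_sum_le], simp, unfold o_def, rule sum_mono)
    fix r
    let ?A = "\<Prod>i<la r - \<mu> r. [:- (c r * q ^ i), 1:]" and ?B = "qpoch [:0, d r:] [:q:] (\<mu> r - la (Suc r))"
    have "la (Suc r) \<le> \<mu> r" "\<mu> r \<le> la r" using True by (auto simp: interlaces_def)
    then have le: "(la r - \<mu> r) + (\<mu> r - la (Suc r)) = la r - la (Suc r)" by simp
    have "degree (smult a (?A * ?B)) \<le> (la r - \<mu> r) + (\<mu> r - la (Suc r))" for a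
      using degree_smult_le[of a "?A * ?B"] degree_mult_le[of ?A ?B]
        deg_c[where e = "c r" and k = "la r - \<mu> r"] deg_q[where b = "d r" and k = "\<mu> r - la (Suc r)"]
      by linarith
    then show "degree (smult (qpoch q q (la r - la (Suc r)) /
                      (qpoch q q (la r - \<mu> r) * qpoch q q (\<mu> r - la (Suc r)) *
                       qpoch (c r * d r) q (la r - la (Suc r)))) (?A * ?B)) \<le> la r - la (Suc r)"
      unfolding le .
  qed
  then show ?thesis using step[of n] by linarith
qed (simp add: skewF_def)

lemma spinF_degree_box: "spinF q n c d la \<in> degree_box n (la 0)"
proof (induction n arbitrary: c la)
  case 0
  show ?case by (simp add: degree_box_1)
next
  case (Suc n)
  show ?case
    unfolding spinF.simps
  proof (intro degree_box_sum degree_box_mult_at_var degree_skewF)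
    fix \<mu> assume "\<mu> \<in> {\<mu> \<in> partitions n. \<mu> \<preceq> la}"
    then have "\<mu> 0 \<le> la 0" by (auto simp: interlaces_def)
    then show "spinF q n (\<lambda>r. c (Suc r)) d \<mu> \<in> degree_box n (la 0)"
      using Suc.IH degree_box_mono by blast
  qed
qed

lemma meval_spinF_cong:
  assumes "\<And>i. i < n \<Longrightarrow> x i = y i"
  shows "meval x (spinF q n c d la) = meval y (spinF q n c d la)"
  using assms vars_degree_box[OF spinF_degree_box[of n c d la]] by (intro meval_cong) auto

text \<open>
  In \<open>two_row\<close> both steps run over the same columns.  The additional column of the second step is empty
  and has weight 1, and a \<open>\<mu>\<close> with too many parts does not interlace with \<open>\<nu>\<close>.
\<close>

lemma sum_skewF_skewF:
  assumes la: "la \<in> partitions (Suc (Suc k))" and \<nu>: "\<nu> \<in> partitions k" "\<And>i. \<nu> i \<le> la i"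
  shows "(\<Sum>\<mu> | \<mu> \<in> partitions (Suc k) \<and> \<mu> \<preceq> la.
            poly (skewF q (Suc k) (\<lambda>r. c (Suc r)) d \<mu> \<nu>) v * poly (skewF q (Suc (Suc k)) c d la \<mu>) u)
       = (\<Sum>p\<le>la 0. hp u (c 0) p * two_row (Suc (Suc k)) u v c d la \<nu> p)"
proof -
  let ?N = "Suc (Suc k)"
  let ?w = "\<lambda>\<mu> r. skew_col u (c r) (d r) (la r) (\<mu> r) (la (Suc r)) *
                    skew_col v (c (Suc r)) (d r) (\<mu> r) (\<nu> r) (\<mu> (Suc r))"
  have "(\<Sum>\<mu> | \<mu> \<in> partitions (Suc k) \<and> \<mu> \<preceq> la.
            poly (skewF q (Suc k) (\<lambda>r. c (Suc r)) d \<mu> \<nu>) v * poly (skewF q ?N c d la \<mu>) u)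
      = (\<Sum>\<mu> | \<mu> \<in> partitions (Suc k) \<and> \<mu> \<preceq> la. \<Prod>r<?N. ?w \<mu> r)"
  proof (rule sum.cong[OF refl])
    fix \<mu> assume "\<mu> \<in> {\<mu> \<in> partitions (Suc k). \<mu> \<preceq> la}"
    then have \<mu>0: "\<And>i. Suc k \<le> i \<Longrightarrow> \<mu> i = 0" by (simp add: partitions_def)
    have "poly (skewF q ?N c d la \<mu>) u = (\<Prod>r<?N. skew_col u (c r) (d r) (la r) (\<mu> r) (la (Suc r)))"
      using la \<mu>0 by (intro poly_skewF_eq_prod) (auto simp: partitions_def)
    moreover have "poly (skewF q (Suc k) (\<lambda>r. c (Suc r)) d \<mu> \<nu>) v
        = (\<Prod>r<Suc k. skew_col v (c (Suc r)) (d r) (\<mu> r) (\<nu> r) (\<mu> (Suc r)))"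
      using \<nu> \<mu>0 by (intro poly_skewF_eq_prod) (auto simp: partitions_def)
    moreover have "\<dots> = (\<Prod>r<?N. skew_col v (c (Suc r)) (d r) (\<mu> r) (\<nu> r) (\<mu> (Suc r)))"
      unfolding prod.lessThan_Suc[of _ "Suc k"] using \<nu> \<mu>0 by (simp add: partitions_def)
    ultimately show "poly (skewF q (Suc k) (\<lambda>r. c (Suc r)) d \<mu> \<nu>) v * poly (skewF q ?N c d la \<mu>) u
        = (\<Prod>r<?N. ?w \<mu> r)"
      by (simp only: prod.distrib mult.commute)
  qed
  also have "\<dots> = (\<Sum>\<mu> | \<mu> \<in> partitions ?N \<and> \<mu> \<preceq> la. \<Prod>r<?N. ?w \<mu> r)"
  proof (rule sum.mono_neutral_left)
    show "{\<mu> \<in> partitions (Suc k). \<mu> \<preceq> la} \<subseteq> {\<mu> \<in> partitions ?N. \<mu> \<preceq> la}"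
      by (auto simp: partitions_def)
    show "\<forall>\<mu>\<in>{\<mu> \<in> partitions ?N. \<mu> \<preceq> la} - {\<mu> \<in> partitions (Suc k). \<mu> \<preceq> la}. (\<Prod>r<?N. ?w \<mu> r) = 0"
    proof
      fix \<mu> assume \<mu>: "\<mu> \<in> {\<mu> \<in> partitions ?N. \<mu> \<preceq> la} - {\<mu> \<in> partitions (Suc k). \<mu> \<preceq> la}"
      have "\<mu> (Suc k) \<noteq> 0"
      proof
        assume "\<mu> (Suc k) = 0"
        moreover have "\<mu> i = 0" if "Suc (Suc k) \<le> i" for i
          using \<mu> that by (simp add: partitions_def)
        ultimately have "\<mu> i = 0" if "Suc k \<le> i" for i
          using that by (cases "i = Suc k") auto
        then show False using \<mu> by (auto simp: partitions_def)
      qed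
      then have "?w \<mu> k = 0"
        using \<nu> by (simp add: skew_col_def partitions_def)
      then show "(\<Prod>r<?N. ?w \<mu> r) = 0"
        by (intro prod_zero) auto
    qed
  qed (rule finite_interlacing)
  also have "\<dots> = (\<Sum>p\<le>la 0. hp u (c 0) p * two_row ?N u v c d la \<nu> p)"
    using sum_two_skew_rows[OF la \<nu>(2), where h = "\<lambda>_. 1"] by simp
  finally show ?thesis .
qed

lemma meval_spinF_two_rows:
  assumes la: "la \<in> partitions (Suc (Suc k))"
  shows "meval x (spinF q (Suc (Suc k)) c d la)
       = (\<Sum>\<nu> | \<nu> \<in> partitions k \<and> (\<forall>i. \<nu> i \<le> la i).
           meval x (spinF q k (\<lambda>r. c (Suc (Suc r))) d \<nu>) *
           (\<Sum>p\<le>la 0. hp (x (Suc k)) (c 0) p * two_row (Suc (Suc k)) (x (Suc k)) (x k) c d la \<nu> p))"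
proof -
  let ?S = "{\<mu> \<in> partitions (Suc k). \<mu> \<preceq> la}"
  let ?R = "{\<nu> \<in> partitions k. \<forall>i. \<nu> i \<le> la i}"
  let ?f = "\<lambda>\<nu>. meval x (spinF q k (\<lambda>r. c (Suc (Suc r))) d \<nu>)"
  let ?g = "\<lambda>\<mu> \<nu>. poly (skewF q (Suc k) (\<lambda>r. c (Suc r)) d \<mu> \<nu>) (x k)"
  let ?h = "\<lambda>\<mu>. poly (skewF q (Suc (Suc k)) c d la \<mu>) (x (Suc k))"
  have finR: "finite ?R"
  proof (rule finite_subset)
    show "?R \<subseteq> {\<nu>. \<forall>i. (i \<in> {..<k} \<longrightarrow> \<nu> i \<in> {..la 0}) \<and> (i \<notin> {..<k} \<longrightarrow> \<nu> i = 0)}"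
    proof clarify
      fix \<nu> i assume \<nu>: "\<nu> \<in> partitions k" "\<forall>i. \<nu> i \<le> la i"
      have "la i \<le> la 0" using la by (simp add: partitions_def antimono_def)
      then show "(i \<in> {..<k} \<longrightarrow> \<nu> i \<in> {..la 0}) \<and> (i \<notin> {..<k} \<longrightarrow> \<nu> i = 0)"
        using \<nu> by (auto simp: partitions_def intro: order_trans)
    qed
  qed (rule finite_set_of_finite_funs; simp)
  have "meval x (spinF q (Suc (Suc k)) c d la)
      = (\<Sum>\<mu>\<in>?S. (\<Sum>\<nu> | \<nu> \<in> partitions k \<and> \<nu> \<preceq> \<mu>. ?f \<nu> * ?g \<mu> \<nu>) * ?h \<mu>)"
    unfolding meval_spinF_Suc ..
  also have "\<dots> = (\<Sum>\<mu>\<in>?S. (\<Sum>\<nu>\<in>?R. ?f \<nu> * ?g \<mu> \<nu>) * ?h \<mu>)"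
  proof (rule sum.cong[OF refl])
    fix \<mu> assume \<mu>: "\<mu> \<in> ?S"
    have "(\<Sum>\<nu> | \<nu> \<in> partitions k \<and> \<nu> \<preceq> \<mu>. ?f \<nu> * ?g \<mu> \<nu>) = (\<Sum>\<nu>\<in>?R. ?f \<nu> * ?g \<mu> \<nu>)"
    proof (rule sum.mono_neutral_left[OF finR])
      show "{\<nu> \<in> partitions k. \<nu> \<preceq> \<mu>} \<subseteq> ?R"
        using \<mu> by (auto simp: interlaces_def intro: order_trans)
    qed (auto simp: skewF_def)
    then show "(\<Sum>\<nu> | \<nu> \<in> partitions k \<and> \<nu> \<preceq> \<mu>. ?f \<nu> * ?g \<mu> \<nu>) * ?h \<mu>
        = (\<Sum>\<nu>\<in>?R. ?f \<nu> * ?g \<mu> \<nu>) * ?h \<mu>"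
      by simp
  qed
  also have "\<dots> = (\<Sum>\<nu>\<in>?R. ?f \<nu> * (\<Sum>\<mu>\<in>?S. ?g \<mu> \<nu> * ?h \<mu>))"
    unfolding sum_distrib_right sum_distrib_left by (subst sum.swap) (simp only: mult.assoc)
  also have "\<dots> = (\<Sum>\<nu>\<in>?R. ?f \<nu> *
      (\<Sum>p\<le>la 0. hp (x (Suc k)) (c 0) p * two_row (Suc (Suc k)) (x (Suc k)) (x k) c d la \<nu> p))"
    by (intro sum.cong refl arg_cong2[where f = "(*)"] sum_skewF_skewF la) auto
  finally show ?thesis .
qed

lemma meval_spinF_swap_last:
  assumes la: "la \<in> partitions (Suc (Suc k))" and cd: "\<And>i j. norm (c i * d j) < 1"
  shows "meval (x \<circ> Transposition.transpose k (Suc k)) (spinF q (Suc (Suc k)) c d la)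
       = meval x (spinF q (Suc (Suc k)) c d la)"
proof -
  let ?y = "x \<circ> Transposition.transpose k (Suc k)"
  have "meval ?y (spinF q k c' d \<nu>) = meval x (spinF q k c' d \<nu>)" for c' \<nu>
    by (rule meval_spinF_cong) (simp add: transpose_def)
  then show ?thesis
    unfolding meval_spinF_two_rows[OF la] using two_row_symmetric[of c d, OF cd]
    by (simp del: two_row.simps spinF.simps)
qed

text \<open>
  A transposition of two of the first \<open>n\<close> variables acts inside the recursion; one that moves the last
  variable is a conjugate of the exchange of the last two.
\<close>

lemma meval_spinF_transpose:
  assumes "la \<in> partitions n" "\<And>i j. norm (c i * d j) < 1" "i < n" "j < n" "i \<noteq> j"
  shows "meval (x \<circ> Transposition.transpose i j) (spinF q n c d la) = meval x (spinF q n c d la)"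
  using assms
proof (induction n arbitrary: c la i j x)
  case (Suc n)
  have old: "meval (x \<circ> Transposition.transpose i j) (spinF q (Suc n) c d la) = meval x (spinF q (Suc n) c d la)"
    if "i < n" "j < n" "i \<noteq> j" for i j x
  proof -
    have "meval (x \<circ> Transposition.transpose i j) (spinF q n (\<lambda>r. c (Suc r)) d \<mu>)
        = meval x (spinF q n (\<lambda>r. c (Suc r)) d \<mu>)" if "\<mu> \<in> partitions n" for \<mu>
      using that \<open>i < n\<close> \<open>j < n\<close> \<open>i \<noteq> j\<close> Suc.prems(2) by (intro Suc.IH) auto
    then show ?thesis
      unfolding meval_spinF_Suc using that by (intro sum.cong refl) (simp add: transpose_def)
  qed
  have new: "meval (x \<circ> Transposition.transpose i n) (spinF q (Suc n) c d la) = meval x (spinF q (Suc n) c d la)"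
    if i: "i < n" for i x
  proof -
    obtain k where n: "n = Suc k" using i by (cases n) auto
    have last: "meval (x \<circ> Transposition.transpose k n) (spinF q (Suc n) c d la) = meval x (spinF q (Suc n) c d la)" for x
      using meval_spinF_swap_last[of la k c d x] Suc.prems(1,2) by (simp add: n)
    show ?thesis
    proof (cases "i = k")
      case False
      then have ik: "i < k" "k < n" using i n by auto
      \<comment> \<open>Here \<open>k = n - 1\<close>, so the middle factor exchanges the last two variables.\<close>
      have eq: "Transposition.transpose i n
          = Transposition.transpose i k \<circ> Transposition.transpose k n \<circ> Transposition.transpose i k"
        using ik n by (auto simp: fun_eq_iff transpose_def)
      show ?thesis
        unfolding eq o_assoc using old[of i k] i ik last by (simp del: spinF.simps)
    qed (simp add: last del: spinF.simps)
  qed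
  show ?case
  proof (cases "i < n \<and> j < n")
    case True
    then show ?thesis using old Suc.prems by blast
  next
    case False
    then consider "i < n" "j = n" | "j < n" "i = n"
      using Suc.prems by linarith
    then show ?thesis
    proof cases
      case 1
      then show ?thesis unfolding 1(2) by (intro new)
    next
      case 2
      then show ?thesis unfolding 2(2) transpose_commute[of n j] by (intro new)
    qed
  qed
qed simp

lemma spinF_in_Sym:
  assumes "la \<in> partitions n" "\<And>i j. norm (c i * d j) < 1"
  shows "spinF q n c d la \<in> Sym n"
proof -
  have "meval (x \<circ> \<pi>) (spinF q n c d la) = meval x (spinF q n c d la)" if "\<pi> permutes {..<n}" for \<pi> x
    using finite_lessThan that
  proof (induction \<pi> arbitrary: x rule: permutes_rev_induct)
    case (swap a b p)
    have "meval (x \<circ> p \<circ> Transposition.transpose a b) (spinF q n c d la) = meval (x \<circ> p) (spinF q n c d la)"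
      by (rule meval_spinF_transpose) (use swap assms in auto)
    then show ?case
      unfolding o_assoc by (rule trans) (rule swap)
  qed simp
  then have "permute_vars \<pi> (spinF q n c d la) = spinF q n c d la" if "\<pi> permutes {..<n}" for \<pi>
    using that by (intro meval_eqI) (simp add: meval_permute_vars permutes_bij)
  then show ?thesis
    using vars_degree_box[OF spinF_degree_box] by (auto simp: Sym_def)
qed

section \<open>Removing a column and removing a variable\<close>

lemma skew_col_decrease:
  assumes "0 < l'" "0 < m" "0 < l"
  shows "skew_col x c d l m l' = skew_col x c d (l - 1) (m - 1) (l' - 1)"
proof -
  obtain k k' k'' where [simp]: "l' = Suc k" "m = Suc k'" "l = Suc k''"
    using assms gr0_implies_Suc by metis
  show ?thesis by (simp add: skew_col_def)
qed

text \<open>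
  All differences of neighbouring parts stay the same, except that \<open>la n\<close> drops by 1 while \<open>\<mu> n\<close> stays
  0.  So the last factor loses the zero at \<open>c n\<close> and one factor of its denominator, and the rest of it
  belongs to the parameter \<open>c n * q\<close>.
\<close>

lemma poly_skewF_remove_column:
  assumes la: "la \<in> partitions (Suc n)" "0 < la n" and \<mu>: "\<mu> \<in> partitions n" "\<mu> \<preceq> la"
  shows "poly (skewF q (Suc n) c d la \<mu>) x
       = (x - c n) / (1 - c n * d n)
         * poly (skewF q (Suc n) (c(n := c n * q)) d (\<lambda>i. la i - 1) (\<lambda>i. \<mu> i - 1)) x"
proof -
  let ?c = "c(n := c n * q)"
  have la_pos: "0 < la i" if "i \<le> n" for i
    using la that unfolding partitions_def antimono_def by (metis (mono_tags, lifting) mem_Collect_eq order_less_le_trans)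
  have \<mu>_pos: "0 < \<mu> i" if "i < n" for i
    using \<mu>(2) la_pos[of "Suc i"] that unfolding interlaces_def by (metis Suc_leI order_less_le_trans)
  have zero: "\<mu> n = 0" "la (Suc n) = 0"
    using la \<mu> by (auto simp: partitions_def)
  obtain l where l: "la n = Suc l"
    using la(2) gr0_implies_Suc by blast
  have last: "skew_col x (c n) (d n) (la n) (\<mu> n) (la (Suc n))
      = (x - c n) / (1 - c n * d n) * skew_col x (c n * q) (d n) (la n - 1) (\<mu> n - 1) (la (Suc n) - 1)"
    by (simp add: zero l skew_col_def hpoch_Suc_left mult_ac)
  have "poly (skewF q (Suc n) c d la \<mu>) x
      = (\<Prod>r<Suc n. skew_col x (c r) (d r) (la r) (\<mu> r) (la (Suc r)))"
    using la \<mu> by (intro poly_skewF_eq_prod) (auto simp: partitions_def)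
  also have "\<dots> = (\<Prod>r<n. skew_col x (c r) (d r) (la r - 1) (\<mu> r - 1) (la (Suc r) - 1))
      * skew_col x (c n) (d n) (la n) (\<mu> n) (la (Suc n))"
    unfolding prod.lessThan_Suc
    by (intro arg_cong2[where f = "(*)"] prod.cong refl skew_col_decrease) (auto intro: la_pos \<mu>_pos)
  also have "\<dots> = (x - c n) / (1 - c n * d n)
      * (\<Prod>r<Suc n. skew_col x (?c r) (d r) (la r - 1) (\<mu> r - 1) (la (Suc r) - 1))"
    unfolding last by simp
  also have "(\<Prod>r<Suc n. skew_col x (?c r) (d r) (la r - 1) (\<mu> r - 1) (la (Suc r) - 1))
      = poly (skewF q (Suc n) ?c d (\<lambda>i. la i - 1) (\<lambda>i. \<mu> i - 1)) x"
    using la \<mu> by (intro poly_skewF_eq_prod[symmetric]) (auto simp: partitions_def)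
  finally show ?thesis .
qed

text \<open>
  The inverse of the removal of the first column of a Young diagram with \<open>n\<close> rows.
\<close>

definition add_column :: "nat \<Rightarrow> (nat \<Rightarrow> nat) \<Rightarrow> nat \<Rightarrow> nat" where
  "add_column n la = (\<lambda>i. if i < n then Suc (la i) else 0)"

lemma add_column_inverse:
  assumes "la \<in> partitions n" "\<And>i. i < n \<Longrightarrow> 0 < la i"
  shows "add_column n (\<lambda>i. la i - 1) = la"
  using assms by (auto simp: add_column_def partitions_def fun_eq_iff)

lemma add_column_minus_1:
  "la \<in> partitions n \<Longrightarrow> (\<lambda>i. add_column n la i - 1) = la"
  by (auto simp: add_column_def partitions_def fun_eq_iff)

lemma add_column_partitions: "la \<in> partitions n \<Longrightarrow> add_column n la \<in> partitions n"
  by (auto simp: add_column_def partitions_def antimono_def)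

lemma partitions_minus_1: "la \<in> partitions n \<Longrightarrow> (\<lambda>i. la i - 1) \<in> partitions n"
  by (auto simp: partitions_def antimono_def intro: diff_le_mono)

lemma partitions_0: "partitions 0 = {\<lambda>_. 0}"
  by (auto simp: partitions_def antimono_def)

text \<open>
  The parameter \<open>c n\<close> is the last one at every level of the recursion, since \<open>c\<close> is shifted each time.
  So every level contributes one of the factors, by \<open>poly_skewF_remove_column\<close>.
\<close>

lemma meval_spinF_remove_column:
  assumes "la \<in> partitions (Suc n)" "0 < la n"
  shows "meval x (spinF q (Suc n) c d la)
       = (\<Prod>i<Suc n. (x i - c n) / (1 - c n * d i))
         * meval x (spinF q (Suc n) (c(n := c n * q)) d (\<lambda>i. la i - 1))"
  using assms
proof (induction n arbitrary: c la)
  case 0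
  then have step: "poly (skewF q (Suc 0) c d la \<mu>) (x 0)
      = (x 0 - c 0) / (1 - c 0 * d 0)
         * poly (skewF q (Suc 0) (c(0 := c 0 * q)) d (\<lambda>i. la i - 1) \<mu>) (x 0)"
    if "\<mu> \<in> partitions 0" "\<mu> \<preceq> la" for \<mu>
  proof -
    have "(\<lambda>i. \<mu> i - 1) = \<mu>" using that(1) by (auto simp: partitions_0)
    then show ?thesis
      using poly_skewF_remove_column[OF 0 that, of c d "x 0"] by simp
  qed
  have same: "{\<mu> \<in> partitions 0. \<mu> \<preceq> la} = {\<mu> \<in> partitions 0. \<mu> \<preceq> (\<lambda>i. la i - 1)}"
    using 0 by (auto simp: partitions_def interlaces_def)
  show ?case
    unfolding meval_spinF_Suc same[symmetric] sum_distrib_left by (intro sum.cong refl) (simp add: step)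
next
  case (Suc n)
  let ?N = "Suc n" and ?C = "c (Suc n)"
  let ?c = "c(Suc n := ?C * q)"
  let ?F = "\<lambda>i. (x i - ?C) / (1 - ?C * d i)"
  have la_pos: "0 < la i" if "i \<le> Suc n" for i
    using Suc.prems that unfolding partitions_def antimono_def
    by (metis (mono_tags, lifting) mem_Collect_eq order_less_le_trans)
  have \<mu>_pos: "0 < \<mu> i" if "\<mu> \<preceq> la" "i < ?N" for \<mu> i
    using that la_pos[of "Suc i"] unfolding interlaces_def by (metis Suc_leI order_less_le_trans)
  have "meval x (spinF q (Suc ?N) c d la)
      = (\<Sum>\<mu> | \<mu> \<in> partitions ?N \<and> \<mu> \<preceq> la.
          (\<Prod>i<Suc ?N. ?F i) * (meval x (spinF q ?N (\<lambda>r. ?c (Suc r)) d (\<lambda>i. \<mu> i - 1)) *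
            poly (skewF q (Suc ?N) ?c d (\<lambda>i. la i - 1) (\<lambda>i. \<mu> i - 1)) (x ?N)))"
    unfolding meval_spinF_Suc[of x ?N]
  proof (rule sum.cong[OF refl])
    fix \<mu> assume "\<mu> \<in> {\<mu> \<in> partitions ?N. \<mu> \<preceq> la}"
    then have \<mu>: "\<mu> \<in> partitions ?N" "\<mu> \<preceq> la" by auto
    have "(\<lambda>r. c (Suc r))(n := ?C * q) = (\<lambda>r. ?c (Suc r))"
      by (auto simp: fun_eq_iff)
    then have "meval x (spinF q ?N (\<lambda>r. c (Suc r)) d \<mu>)
        = (\<Prod>i<?N. ?F i) * meval x (spinF q ?N (\<lambda>r. ?c (Suc r)) d (\<lambda>i. \<mu> i - 1))"
      using Suc.IH[OF \<mu>(1) \<mu>_pos[OF \<mu>(2), of n], of "\<lambda>r. c (Suc r)"] by (simp del: spinF.simps)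
    then show "meval x (spinF q ?N (\<lambda>r. c (Suc r)) d \<mu>) * poly (skewF q (Suc ?N) c d la \<mu>) (x ?N)
        = (\<Prod>i<Suc ?N. ?F i) * (meval x (spinF q ?N (\<lambda>r. ?c (Suc r)) d (\<lambda>i. \<mu> i - 1)) *
            poly (skewF q (Suc ?N) ?c d (\<lambda>i. la i - 1) (\<lambda>i. \<mu> i - 1)) (x ?N))"
      unfolding poly_skewF_remove_column[OF Suc.prems \<mu>] prod.lessThan_Suc[of _ ?N]
      by (simp only: mult_ac)
  qed
  also have "\<dots> = (\<Sum>\<mu> | \<mu> \<in> partitions ?N \<and> \<mu> \<preceq> (\<lambda>i. la i - 1).
          (\<Prod>i<Suc ?N. ?F i) * (meval x (spinF q ?N (\<lambda>r. ?c (Suc r)) d \<mu>) *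
            poly (skewF q (Suc ?N) ?c d (\<lambda>i. la i - 1) \<mu>) (x ?N)))"
  proof (rule sum.reindex_bij_witness[of _ "add_column ?N" "\<lambda>\<mu> i. \<mu> i - 1"])
    fix \<mu> assume "\<mu> \<in> {\<mu> \<in> partitions ?N. \<mu> \<preceq> la}"
    then have \<mu>: "\<mu> \<in> partitions ?N" "\<mu> \<preceq> la" by auto
    show "add_column ?N (\<lambda>i. \<mu> i - 1) = \<mu>"
      using \<mu> by (intro add_column_inverse \<mu>_pos) auto
    show "(\<lambda>i. \<mu> i - 1) \<in> {\<mu> \<in> partitions ?N. \<mu> \<preceq> (\<lambda>i. la i - 1)}"
      using partitions_minus_1[OF \<mu>(1)] \<mu>(2) by (auto intro: diff_le_mono simp: interlaces_def)
  next
    fix \<mu> assume "\<mu> \<in> {\<mu> \<in> partitions ?N. \<mu> \<preceq> (\<lambda>i. la i - 1)}"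
    then have \<mu>: "\<mu> \<in> partitions ?N" "\<mu> \<preceq> (\<lambda>i. la i - 1)" by auto
    show "(\<lambda>i. add_column ?N \<mu> i - 1) = \<mu>"
      by (rule add_column_minus_1[OF \<mu>(1)])
    have "add_column ?N \<mu> i \<le> la i \<and> la (Suc i) \<le> add_column ?N \<mu> i" for i
    proof -
      have "\<mu> i \<le> la i - 1" "la (Suc i) - 1 \<le> \<mu> i"
        using \<mu>(2) by (auto simp: interlaces_def)
      moreover have "i < ?N \<Longrightarrow> 0 < la i" "\<not> i < ?N \<Longrightarrow> la (Suc i) = 0"
        using la_pos[of i] Suc.prems(1) by (auto simp: partitions_def)
      ultimately show ?thesis by (auto simp: add_column_def)
    qed
    then show "add_column ?N \<mu> \<in> {\<mu> \<in> partitions ?N. \<mu> \<preceq> la}"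
      using add_column_partitions[OF \<mu>(1)] by (simp add: interlaces_def)
  qed simp
  also have "\<dots> = (\<Prod>i<Suc ?N. ?F i) * meval x (spinF q (Suc ?N) ?c d (\<lambda>i. la i - 1))"
    unfolding meval_spinF_Suc[of x ?N] sum_distrib_left ..
  finally show ?case .
qed

lemma meval_spinF_at_last_parameter_eq_0:
  assumes "la \<in> partitions (Suc n)" "0 < la n" "x 0 = c n"
  shows "meval x (spinF q (Suc n) c d la) = 0"
proof -
  have "(\<Prod>i<Suc n. (x i - c n) / (1 - c n * d i)) = 0"
    using assms(3) by (intro prod_zero) auto
  then show ?thesis
    unfolding meval_spinF_remove_column[OF assms(1,2)] by (simp only: mult_zero_left)
qed

lemma partitions_Suc_cases:
  assumes "la \<in> partitions (Suc n)"
  obtains "la \<in> partitions n" "la n = 0" | "la \<notin> partitions n" "0 < la n"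
proof (cases "la n = 0")
  case True
  have "la i = 0" if "n \<le> i" for i
    using assms that True by (cases "i = n") (auto simp: partitions_def)
  then show ?thesis using that True assms by (auto simp: partitions_def)
next
  case False
  then show ?thesis using that by (auto simp: partitions_def)
qed

lemma partitions_mono: "m \<le> n \<Longrightarrow> partitions m \<subseteq> partitions n"
  by (auto simp: partitions_def)

text \<open>
  At this point every \<open>\<mu>\<close> in the recursion with the maximal number of parts contributes 0, so that all
  partitions in the recursion have one part less than they could have.  The last column is then empty at every
  level, and what remains is the recursion with one variable less.
\<close>

lemma meval_spinF_at_last_parameter:
  assumes "la \<in> partitions n"
  shows "meval (case_nat (c n) x) (spinF q (Suc n) c d la) = meval x (spinF q n c d la)"
  using assms
proof (induction n arbitrary: c la)
  case 0
  then have la: "la = (\<lambda>_. 0)" by (simp add: partitions_0)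
  have "{\<mu>. \<mu> = (\<lambda>_. 0) \<and> \<mu> \<preceq> la} = {\<lambda>_. 0}"
    by (auto simp: la interlaces_def)
  moreover have "poly (skewF q (Suc 0) c d la (\<lambda>_. 0)) y = 1" for y
    by (subst poly_skewF_eq_prod) (simp_all add: la)
  ultimately show ?case
    unfolding meval_spinF_Suc by (simp add: partitions_0)
next
  case (Suc n)
  let ?x = "case_nat (c (Suc n)) x"
  have "meval ?x (spinF q (Suc (Suc n)) c d la)
      = (\<Sum>\<mu> | \<mu> \<in> partitions (Suc n) \<and> \<mu> \<preceq> la.
          meval ?x (spinF q (Suc n) (\<lambda>r. c (Suc r)) d \<mu>) * poly (skewF q (Suc (Suc n)) c d la \<mu>) (x n))"
    unfolding meval_spinF_Suc[of ?x "Suc n"] by simp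
  also have "\<dots> = (\<Sum>\<mu> | \<mu> \<in> partitions n \<and> \<mu> \<preceq> la.
          meval ?x (spinF q (Suc n) (\<lambda>r. c (Suc r)) d \<mu>) * poly (skewF q (Suc (Suc n)) c d la \<mu>) (x n))"
  proof (rule sum.mono_neutral_right[OF finite_interlacing])
    show "{\<mu> \<in> partitions n. \<mu> \<preceq> la} \<subseteq> {\<mu> \<in> partitions (Suc n). \<mu> \<preceq> la}"
      using partitions_mono[of n "Suc n"] by auto
    show "\<forall>\<mu>\<in>{\<mu> \<in> partitions (Suc n). \<mu> \<preceq> la} - {\<mu> \<in> partitions n. \<mu> \<preceq> la}.
       meval ?x (spinF q (Suc n) (\<lambda>r. c (Suc r)) d \<mu>) * poly (skewF q (Suc (Suc n)) c d la \<mu>) (x n) = 0"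
    proof
      fix \<mu> assume "\<mu> \<in> {\<mu> \<in> partitions (Suc n). \<mu> \<preceq> la} - {\<mu> \<in> partitions n. \<mu> \<preceq> la}"
      then have \<mu>: "\<mu> \<in> partitions (Suc n)" "\<mu> \<notin> partitions n" by auto
      then have "0 < \<mu> n"
        by (cases rule: partitions_Suc_cases) auto
      with \<mu>(1) have "meval ?x (spinF q (Suc n) (\<lambda>r. c (Suc r)) d \<mu>) = 0"
        by (rule meval_spinF_at_last_parameter_eq_0) simp
      then show "meval ?x (spinF q (Suc n) (\<lambda>r. c (Suc r)) d \<mu>)
          * poly (skewF q (Suc (Suc n)) c d la \<mu>) (x n) = 0"
        by simp
    qed
  qed
  also have "\<dots> = (\<Sum>\<mu> | \<mu> \<in> partitions n \<and> \<mu> \<preceq> la.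
          meval x (spinF q n (\<lambda>r. c (Suc r)) d \<mu>) * poly (skewF q (Suc n) c d la \<mu>) (x n))"
  proof (rule sum.cong[OF refl])
    fix \<mu> assume "\<mu> \<in> {\<mu> \<in> partitions n. \<mu> \<preceq> la}"
    then have \<mu>: "\<mu> \<in> partitions n" by simp
    have zero: "\<And>i. n \<le> i \<Longrightarrow> \<mu> i = 0" "\<And>i. Suc n \<le> i \<Longrightarrow> la i = 0"
      using \<mu> Suc.prems by (auto simp: partitions_def)
    have "poly (skewF q (Suc (Suc n)) c d la \<mu>) (x n) = poly (skewF q (Suc n) c d la \<mu>) (x n)"
      using zero by (simp add: poly_skewF_eq_prod)
    then show "meval ?x (spinF q (Suc n) (\<lambda>r. c (Suc r)) d \<mu>) * poly (skewF q (Suc (Suc n)) c d la \<mu>) (x n)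
        = meval x (spinF q n (\<lambda>r. c (Suc r)) d \<mu>) * poly (skewF q (Suc n) c d la \<mu>) (x n)"
      using Suc.IH[OF \<mu>, of "\<lambda>r. c (Suc r)"] by (simp del: spinF.simps)
  qed
  also have "\<dots> = meval x (spinF q (Suc n) c d la)"
    unfolding meval_spinF_Suc ..
  finally show ?case .
qed

end

section \<open>Linear independence\<close>

definition box_partitions :: "nat \<Rightarrow> nat \<Rightarrow> (nat \<Rightarrow> nat) set" where
  "box_partitions n L = {la \<in> partitions n. la 0 \<le> L}"

lemma finite_box_partitions: "finite (box_partitions n L)"
proof (rule finite_subset)
  show "box_partitions n L
      \<subseteq> {la. \<forall>i. (i \<in> {..<n} \<longrightarrow> la i \<in> {..L}) \<and> (i \<notin> {..<n} \<longrightarrow> la i = 0)}"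
  proof clarify
    fix la i assume "la \<in> box_partitions n L"
    then have la: "la \<in> partitions n" "la 0 \<le> L"
      by (auto simp: box_partitions_def)
    then have "la i \<le> la 0" by (simp add: partitions_def antimono_def)
    then show "(i \<in> {..<n} \<longrightarrow> la i \<in> {..L}) \<and> (i \<notin> {..<n} \<longrightarrow> la i = 0)"
      using la by (auto simp: partitions_def)
  qed
qed (rule finite_set_of_finite_funs; simp)

context q_in_unit_disc
begin

text \<open>
  The outer induction is on the number of variables, the inner one on the bound \<open>L\<close>.  The parameters \<open>c\<close> must be
  arbitrary in both: the first reduction drops a parameter, the second one replaces \<open>c n\<close> by
  \<open>c n * q\<close>.
\<close>

lemma spinF_family_independent:
  assumes "\<And>i j. norm (c i * d j) < 1"
    and "\<And>x. (\<Sum>la\<in>box_partitions n L. u la * meval x (spinF q n c d la)) = 0"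
    and "la \<in> box_partitions n L"
  shows "u la = 0"
  using assms
proof (induction n arbitrary: c u la L)
  case 0
  have "box_partitions 0 L = {\<lambda>_. 0}"
    by (auto simp: box_partitions_def partitions_0)
  with 0(2,3) show ?case by simp
next
  case (Suc n)
  have last_part_0: "u la = 0"
    if cd: "\<And>i j. norm (c i * d j) < 1"
      and sum0: "\<And>x. (\<Sum>la\<in>box_partitions (Suc n) L. u la * meval x (spinF q (Suc n) c d la)) = 0"
      and la: "la \<in> box_partitions (Suc n) L" "la \<in> partitions n" for c u la L
  proof (rule Suc.IH[where c = c and L = L and u = u and la = la])
    show "norm (c i * d j) < 1" for i j
      by (rule cd)
    show "la \<in> box_partitions n L"
      using la by (simp add: box_partitions_def)
    fix x
    let ?x = "case_nat (c n) x"
    have "(\<Sum>la\<in>box_partitions n L. u la * meval x (spinF q n c d la))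
        = (\<Sum>la\<in>box_partitions n L. u la * meval ?x (spinF q (Suc n) c d la))"
      by (intro sum.cong refl arg_cong2[where f = "(*)"] meval_spinF_at_last_parameter[symmetric])
        (simp add: box_partitions_def)
    also have "\<dots> = (\<Sum>la\<in>box_partitions (Suc n) L. u la * meval ?x (spinF q (Suc n) c d la))"
    proof (rule sum.mono_neutral_left[OF finite_box_partitions])
      show "box_partitions n L \<subseteq> box_partitions (Suc n) L"
        using partitions_mono[of n "Suc n"] by (auto simp: box_partitions_def)
      show "\<forall>la\<in>box_partitions (Suc n) L - box_partitions n L. u la * meval ?x (spinF q (Suc n) c d la) = 0"
      proof
        fix la assume "la \<in> box_partitions (Suc n) L - box_partitions n L"
        then have la: "la \<in> partitions (Suc n)" "la \<notin> partitions n"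
          by (auto simp: box_partitions_def)
        then have "0 < la n"
          by (cases rule: partitions_Suc_cases) auto
        with la(1) have "meval ?x (spinF q (Suc n) c d la) = 0"
          by (rule meval_spinF_at_last_parameter_eq_0) simp
        then show "u la * meval ?x (spinF q (Suc n) c d la) = 0" by simp
      qed
    qed
    finally show "(\<Sum>la\<in>box_partitions n L. u la * meval x (spinF q n c d la)) = 0"
      unfolding sum0 .
  qed
  from Suc.prems show ?case
  proof (induction L arbitrary: c u la)
    case 0
    have la: "la \<in> partitions (Suc n)" "la 0 = 0"
      using 0(3) by (auto simp: box_partitions_def)
    have "la n \<le> la 0"
      using la(1) by (simp add: partitions_def antimono_def)
    with la have "la \<in> partitions n"
      by (auto elim: partitions_Suc_cases)
    then show ?case
      by (rule last_part_0[where c = c and L = 0 and u = u and la = la, OF 0])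
  next
    case (Suc L)
    show ?case
    proof (cases "la \<in> partitions n")
      case True
      show ?thesis
        by (rule last_part_0[where c = c and L = "Suc L" and u = u and la = la, OF Suc.prems True])
    next
      case False
      let ?N = "Suc n"
      let ?B = "box_partitions ?N (Suc L)"
      let ?c = "c(n := c n * q)"
      let ?P = "\<lambda>x. \<Prod>i<?N. (x i - c n) / (1 - c n * d i)"
      let ?u = "\<lambda>la. u (add_column ?N la)"
      define g where "g = (\<Sum>la\<in>box_partitions ?N L. mscale (?u la) (spinF q ?N ?c d la))"
      have add_column_box: "add_column ?N la \<in> ?B" if "la \<in> box_partitions ?N L" for la
        using that add_column_partitions by (auto simp: box_partitions_def add_column_def)
      have large: "la \<in> partitions ?N \<and> 0 < la n" if "la \<in> ?B - partitions n" for la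
        using that by (auto simp: box_partitions_def elim: partitions_Suc_cases)
      have pos: "0 < la i" if "la \<in> partitions ?N" "0 < la n" "i < ?N" for la i
      proof -
        have "la n \<le> la i" using that by (simp add: partitions_def antimono_def)
        with that show ?thesis by linarith
      qed
      have minus_box: "(\<lambda>i. la i - 1) \<in> box_partitions ?N L" if "la \<in> ?B" for la
        using that partitions_minus_1[of la ?N] by (auto simp: box_partitions_def)
      have meval_g: "meval x g = (\<Sum>la\<in>box_partitions ?N L. ?u la * meval x (spinF q ?N ?c d la))" for x
        by (simp only: g_def meval_sum meval_mscale)
      have sum_g: "?P x * meval x g = 0" for x
      proof -
        have "0 = (\<Sum>la\<in>?B. u la * meval x (spinF q ?N c d la))"
          using Suc.prems(2) by simp
        also have "\<dots> = (\<Sum>la\<in>?B - partitions n. u la * meval x (spinF q ?N c d la))"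
          using last_part_0[OF Suc.prems(1,2)]
          by (intro sum.mono_neutral_right finite_box_partitions) auto
        also have "\<dots> = (\<Sum>la\<in>?B - partitions n. u la * (?P x * meval x (spinF q ?N ?c d (\<lambda>i. la i - 1))))"
          using large by (intro sum.cong refl arg_cong2[where f = "(*)"] meval_spinF_remove_column) blast+
        also have "\<dots> = (\<Sum>la\<in>box_partitions ?N L. ?u la * (?P x * meval x (spinF q ?N ?c d la)))"
        proof (rule sum.reindex_bij_witness[of _ "add_column ?N" "\<lambda>la i. la i - 1"])
          fix la assume la: "la \<in> ?B - partitions n"
          show eq: "add_column ?N (\<lambda>i. la i - 1) = la"
            using large[OF la] pos by (intro add_column_inverse) auto
          show "(\<lambda>i. la i - 1) \<in> box_partitions ?N L"
            using minus_box la by blast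
          show "?u (\<lambda>i. la i - 1) * (?P x * meval x (spinF q ?N ?c d (\<lambda>i. la i - 1)))
              = u la * (?P x * meval x (spinF q ?N ?c d (\<lambda>i. la i - 1)))"
            unfolding eq ..
        next
          fix la assume la: "la \<in> box_partitions ?N L"
          then show "(\<lambda>i. add_column ?N la i - 1) = la"
            by (intro add_column_minus_1) (simp add: box_partitions_def)
          have "add_column ?N la n \<noteq> 0" by (simp add: add_column_def)
          then show "add_column ?N la \<in> ?B - partitions n"
            using add_column_box[OF la] by (auto simp: partitions_def)
        qed
        also have "\<dots> = ?P x * meval x g"
          by (simp only: meval_g sum_distrib_left mult.left_commute)
        finally show ?thesis by simp
      qed
      \<comment> \<open>The values determine a polynomial, so the factor can be cancelled in the integral domain of polynomials,
        although the product of the values says nothing about \<open>g\<close> at the zeros of the factor.\<close>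
      have "(\<Prod>i<?N. mvar i - mconst (c n)) * g = 0"
      proof (rule meval_eq_0_imp)
        fix x
        have ne: "1 - c n * d i \<noteq> 0" for i
          using Suc.prems(1)[of n i] by auto
        have "?P x = (\<Prod>i<?N. x i - c n) / (\<Prod>i<?N. 1 - c n * d i)"
          by (rule prod_dividef)
        moreover have "(\<Prod>i<?N. 1 - c n * d i) \<noteq> 0"
          using ne by (simp only: prod_zero_iff finite_lessThan) blast
        ultimately have "(\<Prod>i<?N. x i - c n) = 0 \<or> meval x g = 0"
          using sum_g[of x] by (simp only: divide_eq_0_iff mult_eq_0_iff) blast
        then show "meval x ((\<Prod>i<?N. mvar i - mconst (c n)) * g) = 0"
          by (simp only: meval_mult meval_prod meval_diff meval_mvar meval_mconst mult_eq_0_iff)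
      qed
      \<comment> \<open>The factor that is to be cancelled takes the value 1 where all variables equal \<open>c n + 1\<close>.\<close>
      moreover have "(\<Prod>i<?N. mvar i - mconst (c n)) \<noteq> 0"
      proof
        assume "(\<Prod>i<?N. mvar i - mconst (c n)) = 0"
        then have "meval (\<lambda>_. c n + 1) (\<Prod>i<?N. mvar i - mconst (c n)) = 0"
          by (simp only: meval_0)
        then show False
          by (simp only: meval_prod meval_diff meval_mvar meval_mconst) simp
      qed
      ultimately have "g = 0"
        by (simp only: mult_eq_0_iff) blast
      moreover have "norm (?c i * d j) < 1" for i j
      proof (cases "i = n")
        case True
        have "norm (c n * q * d j) = norm (c n * d j) * norm q"
          by (simp add: norm_mult)
        also have "\<dots> \<le> norm (c n * d j) * 1"
          using q_lt_1 by (intro mult_left_mono) auto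
        also have "\<dots> < 1" using Suc.prems(1)[of n j] by simp
        finally show ?thesis using True by simp
      qed (use Suc.prems(1) in simp)
      ultimately have "?u (\<lambda>i. la i - 1) = 0"
        by (intro Suc.IH[where c = ?c and u = ?u and la = "\<lambda>i. la i - 1", OF _ _ minus_box[OF Suc.prems(3)]])
          (simp_all only: meval_g[symmetric] meval_0)
      moreover have "add_column ?N (\<lambda>i. la i - 1) = la"
        using large[of la] False Suc.prems(3) pos by (intro add_column_inverse) auto
      ultimately show ?thesis by simp
    qed
  qed
qed

end

section \<open>Symmetric polynomials of bounded degree and the basis theorem\<close>

lemma Sym_iff_meval:
  "p \<in> Sym n \<longleftrightarrow> vars p \<subseteq> {..<n} \<and> (\<forall>\<pi> x. \<pi> permutes {..<n} \<longrightarrow> meval (x \<circ> \<pi>) p = meval x p)"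
proof -
  have "permute_vars \<pi> p = p \<longleftrightarrow> (\<forall>x. meval (x \<circ> \<pi>) p = meval x p)" if "\<pi> permutes {..<n}" for \<pi>
    using meval_permute_vars[OF permutes_bij[OF that]] meval_eqI by metis
  then show ?thesis by (auto simp: Sym_def)
qed

lemma degree_box_mscale:
  assumes "p \<in> degree_box n L"
  shows "mscale a p \<in> degree_box n L"
proof -
  have "Poly_Mapping.keys (mscale a p) \<subseteq> Poly_Mapping.keys p"
    by (auto simp: in_keys_iff)
  with assms show ?thesis by (auto simp: degree_box_def)
qed

lemma subspace_Sym_degree_box: "mpoly.subspace (Sym n \<inter> degree_box n L)"
proof (rule mpoly.subspaceI)
  show "0 \<in> Sym n \<inter> degree_box n L"
    by (simp add: degree_box_0 Sym_iff_meval vars_def)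
  show "p + p' \<in> Sym n \<inter> degree_box n L" if "p \<in> Sym n \<inter> degree_box n L" "p' \<in> Sym n \<inter> degree_box n L" for p p'
    using that degree_box_add[of p n L p'] vars_degree_box[of "p + p'" n L]
    by (auto simp: Sym_iff_meval meval_add)
  show "mscale a p \<in> Sym n \<inter> degree_box n L" if "p \<in> Sym n \<inter> degree_box n L" for a p
    using that degree_box_mscale[of p n L a] vars_degree_box[of "mscale a p" n L]
    by (auto simp: Sym_iff_meval meval_mscale)
qed

lemma Sym_degree_box: "p \<in> Sym n \<Longrightarrow> \<exists>L. p \<in> Sym n \<inter> degree_box n L"
  using degree_box_exists[of p n] by (auto simp: Sym_def)

lemma subspace_Sym: "mpoly.subspace (Sym n)"
proof (rule mpoly.subspaceI)
  show "0 \<in> Sym n"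
    using mpoly.subspace_0[OF subspace_Sym_degree_box[of n 0]] by simp
  show "p + p' \<in> Sym n" if p: "p \<in> Sym n" and p': "p' \<in> Sym n" for p p'
  proof -
    obtain L L' where "p \<in> Sym n \<inter> degree_box n L" "p' \<in> Sym n \<inter> degree_box n L'"
      using Sym_degree_box[OF p] Sym_degree_box[OF p'] by blast
    then have "p \<in> Sym n \<inter> degree_box n (max L L')" "p' \<in> Sym n \<inter> degree_box n (max L L')"
      using degree_box_mono[of L "max L L'"] degree_box_mono[of L' "max L L'"] by auto
    then show ?thesis
      using mpoly.subspace_add[OF subspace_Sym_degree_box] by blast
  qed
  show "mscale a p \<in> Sym n" if "p \<in> Sym n" for a p
    using Sym_degree_box[OF that] mpoly.subspace_scale[OF subspace_Sym_degree_box] by blast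
qed

lemma sorting_permutation:
  fixes g :: "nat \<Rightarrow> nat"
  obtains \<pi> where "\<pi> permutes {..<n}" "\<And>i j. i \<le> j \<Longrightarrow> j < n \<Longrightarrow> g (\<pi> j) \<le> g (\<pi> i)"
proof -
  let ?ys = "map g [0..<n]"
  let ?xs = "rev (sort ?ys)"
  have "mset ?xs = mset ?ys" by simp
  then obtain \<pi> where \<pi>: "\<pi> permutes {..<length ?ys}" "permute_list \<pi> ?ys = ?xs"
    by (rule mset_eq_permutation)
  have nth: "?xs ! i = g (\<pi> i)" if "i < n" for i
  proof -
    have "\<pi> i < n" using \<pi>(1) that permutes_in_image[OF \<pi>(1), of i] by simp
    moreover have "?xs ! i = ?ys ! \<pi> i"
      unfolding \<pi>(2)[symmetric] by (rule permute_list_nth[OF \<pi>(1)]) (simp add: that)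
    ultimately show ?thesis by simp
  qed
  have "g (\<pi> j) \<le> g (\<pi> i)" if "i \<le> j" "j < n" for i j
    using sorted_rev_nth_mono[of ?xs i j] that nth by simp
  with \<pi>(1) show ?thesis by (intro that[of \<pi>]) auto
qed

text \<open>
  The monomials whose exponents form a partition, one in each orbit of the symmetric group.
\<close>

definition dominant_monomials :: "nat \<Rightarrow> nat \<Rightarrow> (nat \<Rightarrow>\<^sub>0 nat) set" where
  "dominant_monomials n L = {m. Poly_Mapping.lookup m \<in> box_partitions n L}"

lemma dominant_monomials_card:
  "finite (dominant_monomials n L) \<and> card (dominant_monomials n L) \<le> card (box_partitions n L)"
proof -
  have inj: "inj_on Poly_Mapping.lookup (dominant_monomials n L)"
    by (rule inj_onI) (auto intro: poly_mapping_eqI)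
  have sub: "Poly_Mapping.lookup ` dominant_monomials n L \<subseteq> box_partitions n L"
    by (auto simp: dominant_monomials_def)
  show ?thesis
    using inj_on_finite[OF inj sub finite_box_partitions] card_inj_on_le[OF inj sub finite_box_partitions]
    by blast
qed

lemma Sym_eqI:
  assumes "p \<in> Sym n \<inter> degree_box n L" "p' \<in> Sym n \<inter> degree_box n L"
    and eq: "\<And>m. m \<in> dominant_monomials n L \<Longrightarrow> Poly_Mapping.lookup p m = Poly_Mapping.lookup p' m"
  shows "p = p'"
proof (rule poly_mapping_eqI)
  fix m
  show "Poly_Mapping.lookup p m = Poly_Mapping.lookup p' m"
  proof (cases "Poly_Mapping.keys m \<subseteq> {..<n} \<and> (\<forall>i. Poly_Mapping.lookup m i \<le> L)")
    case False
    then have "m \<notin> Poly_Mapping.keys p" "m \<notin> Poly_Mapping.keys p'"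
      using assms by (auto simp: degree_box_def)
    then show ?thesis by (simp add: in_keys_iff)
  next
    case True
    obtain \<pi> where \<pi>: "\<pi> permutes {..<n}"
      and mono: "\<And>i j. i \<le> j \<Longrightarrow> j < n \<Longrightarrow> Poly_Mapping.lookup m (\<pi> j) \<le> Poly_Mapping.lookup m (\<pi> i)"
      using sorting_permutation[where g = "Poly_Mapping.lookup m" and n = n] by blast
    have bij: "bij \<pi>" by (rule permutes_bij[OF \<pi>])
    let ?m = "Poly_Mapping.map_key \<pi> m"
    have lookup: "Poly_Mapping.lookup ?m i = Poly_Mapping.lookup m (\<pi> i)" for i
      using bij by (simp add: map_key.rep_eq bij_is_inj)
    have zero: "Poly_Mapping.lookup m (\<pi> i) = 0" if "n \<le> i" for i
    proof -
      have "\<pi> i = i" using permutes_not_in[OF \<pi>, of i] that by simp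
      moreover have "i \<notin> Poly_Mapping.keys m" using True that by auto
      ultimately show ?thesis by (simp add: in_keys_iff)
    qed
    have "Poly_Mapping.lookup m (\<pi> j) \<le> Poly_Mapping.lookup m (\<pi> i)" if "i \<le> j" for i j
      using mono[OF that] zero[of j] by (cases "j < n") auto
    then have "?m \<in> dominant_monomials n L"
      using True zero by (simp add: dominant_monomials_def box_partitions_def partitions_def antimono_def lookup)
    then have "Poly_Mapping.lookup p ?m = Poly_Mapping.lookup p' ?m"
      by (rule eq)
    moreover have "Poly_Mapping.lookup r ?m = Poly_Mapping.lookup r m" if "r \<in> Sym n" for r
      using that \<pi> lookup_permute_vars[OF bij, of r m] by (simp add: Sym_def)
    ultimately show ?thesis using assms by simp
  qed
qed

text \<open>
  Restricting a polynomial to its coefficients at the dominant monomials is linear, and it is injective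
  on symmetric polynomials by \<open>Sym_eqI\<close>.  Hence it maps \<open>A\<close> to an independent set in the span of the dominant
  monomials.
\<close>

lemma Sym_independent_card_le:
  assumes ind: "mpoly.independent A" and sub: "A \<subseteq> Sym n \<inter> degree_box n L"
  shows "finite A \<and> card A \<le> card (box_partitions n L)"
proof -
  interpret endo: vector_space_pair mscale mscale ..
  let ?M = "dominant_monomials n L"
  have finM: "finite ?M" and cardM: "card ?M \<le> card (box_partitions n L)"
    using dominant_monomials_card by auto
  define T where "T p = (\<Sum>m\<in>?M. Poly_Mapping.single m (Poly_Mapping.lookup p m))" for p :: cmpoly
  have lookup_T: "Poly_Mapping.lookup (T p) m = (if m \<in> ?M then Poly_Mapping.lookup p m else 0)" for p m
    using finM by (simp add: T_def lookup_sum lookup_single when_def)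
  have lin: "Vector_Spaces.linear mscale mscale T"
    unfolding Vector_Spaces.linear_iff using mpoly.vector_space_axioms
    by (auto intro!: poly_mapping_eqI simp: lookup_T lookup_add)
  have span: "mpoly.span A \<subseteq> Sym n \<inter> degree_box n L"
    by (rule mpoly.span_minimal[OF sub subspace_Sym_degree_box])
  have inj: "inj_on T (mpoly.span A)"
  proof (rule inj_onI)
    fix p p' assume p: "p \<in> mpoly.span A" "p' \<in> mpoly.span A" and eq: "T p = T p'"
    show "p = p'"
    proof (rule Sym_eqI)
      show "p \<in> Sym n \<inter> degree_box n L" "p' \<in> Sym n \<inter> degree_box n L"
        using p span by auto
      show "Poly_Mapping.lookup p m = Poly_Mapping.lookup p' m" if "m \<in> ?M" for m
        using lookup_T[of p m] lookup_T[of p' m] that eq by simp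
    qed
  qed
  have ind_T: "mpoly.independent (T ` A)"
    by (rule endo.linear_independent_injective_image[OF lin ind inj])
  have single: "Poly_Mapping.single m a = mscale a (Poly_Mapping.single m 1)" for m a
    by (rule poly_mapping_eqI) (simp add: lookup_single when_def)
  have "T ` A \<subseteq> mpoly.span ((\<lambda>m. Poly_Mapping.single m 1) ` ?M)"
    unfolding T_def
    by (intro image_subsetI mpoly.span_sum, subst single, intro mpoly.span_scale mpoly.span_base imageI)
  with ind_T have T: "finite (T ` A)" "card (T ` A) \<le> card ((\<lambda>m. Poly_Mapping.single m (1::complex)) ` ?M)"
    using mpoly.independent_span_bound[of "(\<lambda>m. Poly_Mapping.single m 1) ` ?M" "T ` A"] finM by auto
  have injA: "inj_on T A"
    by (rule inj_on_subset[OF inj mpoly.span_superset])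
  have "finite A" using T(1) injA by (rule finite_imageD)
  moreover have "card A \<le> card (box_partitions n L)"
    using T(2) card_image_le[OF finM, of "\<lambda>m. Poly_Mapping.single m (1::complex)"] cardM card_image[OF injA]
    by linarith
  ultimately show ?thesis by blast
qed

context q_in_unit_disc
begin

text \<open>
  Independence is \<open>spinF_family_independent\<close>, as finitely many partitions lie in a common box.  For spanning, a
  symmetric \<open>p\<close> outside the span of the family for a box that contains all its exponents would extend that
  family to an independent set that is larger than \<open>Sym_independent_card_le\<close> admits.
\<close>

lemma spinF_basis:
  assumes cd: "\<And>i j. norm (c i * d j) < 1"
  shows "inj_on (spinF q n c d) (partitions n)"
    and "mpoly.independent (spinF q n c d ` partitions n)"
    and "mpoly.span (spinF q n c d ` partitions n) = Sym n"
proof -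
  let ?F = "spinF q n c d"
  have combination_0: "u la = 0"
    if fin: "finite K" and sub: "K \<subseteq> partitions n"
      and sum0: "(\<Sum>la\<in>K. mscale (u la) (?F la)) = 0" and la: "la \<in> K" for K u la
  proof -
    obtain L where L: "\<And>la. la \<in> K \<Longrightarrow> la 0 \<le> L"
      using finite_imageI[OF fin, of "\<lambda>la. la 0"] unfolding finite_nat_set_iff_bounded_le by blast
    have K: "K \<subseteq> box_partitions n L"
      using sub L by (auto simp: box_partitions_def)
    let ?u = "\<lambda>la. if la \<in> K then u la else 0"
    have "?u la = 0"
    proof (rule spinF_family_independent[where c = c and d = d and n = n and L = L and u = ?u and la = la])
      fix x
      have "(\<Sum>la\<in>box_partitions n L. ?u la * meval x (?F la)) = (\<Sum>la\<in>K. ?u la * meval x (?F la))"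
        using K by (intro sum.mono_neutral_right finite_box_partitions) auto
      also have "\<dots> = meval x (\<Sum>la\<in>K. mscale (u la) (?F la))"
        by (simp add: meval_sum meval_mscale)
      finally show "(\<Sum>la\<in>box_partitions n L. ?u la * meval x (?F la)) = 0"
        using sum0 by simp
    qed (use cd K la in auto)
    with la show ?thesis by simp
  qed
  show inj: "inj_on ?F (partitions n)"
  proof (rule inj_onI, rule ccontr)
    fix la la' assume la: "la \<in> partitions n" "la' \<in> partitions n" "?F la = ?F la'" "la \<noteq> la'"
    have "(\<Sum>\<mu>\<in>{la, la'}. mscale (if \<mu> = la then 1 else - 1) (?F \<mu>)) = 0"
      using la(3,4) by (simp add: mpoly.scale_minus_left del: spinF.simps)
    from combination_0[OF _ _ this, of la] la show False by simp
  qed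
  have ind: "mpoly.independent (?F ` K)" if K: "K \<subseteq> partitions n" for K
    unfolding mpoly.independent_explicit_module
  proof (intro allI impI)
    fix t u v assume t: "finite t" "t \<subseteq> ?F ` K" "(\<Sum>v\<in>t. mscale (u v) v) = 0" "v \<in> t"
    then obtain K' where K': "K' \<subseteq> K" "finite K'" "t = ?F ` K'"
      by (meson finite_subset_image)
    have "inj_on ?F K'" using inj K K'(1) by (meson inj_on_subset)
    then have "(\<Sum>la\<in>K'. mscale (u (?F la)) (?F la)) = 0"
      using t(3) unfolding K'(3) by (simp add: sum.reindex)
    then have "u (?F la) = 0" if "la \<in> K'" for la
      using combination_0[of K' "\<lambda>la. u (?F la)" la] K' K that by blast
    then show "u v = 0" using t(4) K'(3) by blast
  qed
  show "mpoly.independent (?F ` partitions n)"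
    by (rule ind) simp
  show "mpoly.span (?F ` partitions n) = Sym n"
  proof
    show "mpoly.span (?F ` partitions n) \<subseteq> Sym n"
      using spinF_in_Sym cd by (intro mpoly.span_minimal subspace_Sym) auto
    show "Sym n \<subseteq> mpoly.span (?F ` partitions n)"
    proof
      fix p assume p: "p \<in> Sym n"
      then obtain L where L: "p \<in> degree_box n L"
        using Sym_degree_box by blast
      let ?B = "box_partitions n L"
      have B: "?B \<subseteq> partitions n" by (auto simp: box_partitions_def)
      have "p \<in> mpoly.span (?F ` ?B)"
      proof (rule ccontr)
        assume no: "p \<notin> mpoly.span (?F ` ?B)"
        then have "mpoly.independent (insert p (?F ` ?B))"
          using ind[OF B] by (simp add: mpoly.independent_insert)
        moreover have "insert p (?F ` ?B) \<subseteq> Sym n \<inter> degree_box n L"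
        proof -
          have "?F la \<in> Sym n \<inter> degree_box n L" if "la \<in> ?B" for la
            using that spinF_in_Sym[of la n c d] cd degree_box_mono[OF _ spinF_degree_box[of n c d la]]
            by (auto simp: box_partitions_def)
          with p L show ?thesis by blast
        qed
        ultimately have "card (insert p (?F ` ?B)) \<le> card ?B"
          using Sym_independent_card_le by blast
        moreover have "p \<notin> ?F ` ?B" using no mpoly.span_base by blast
        moreover have "card (?F ` ?B) = card ?B"
          using inj B by (meson card_image inj_on_subset)
        ultimately show False using finite_box_partitions[of n L] by simp
      qed
      then show "p \<in> mpoly.span (?F ` partitions n)"
        using mpoly.span_mono[of "?F ` ?B" "?F ` partitions n"] B by blast
    qed
  qed
qed

end

theorem theorem1p3:
  fixes n :: nat and q :: complex and a b :: "nat \<Rightarrow> complex"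
  assumes "norm q < 1"
    and "\<And>i. i < n \<Longrightarrow> norm (a i) < 1"
    and "\<And>i. i < n \<Longrightarrow> norm (b i) < 1"
  shows "inj_on (spinF q n a b) (partitions n) \<and>
         mpoly.independent (spinF q n a b ` partitions n) \<and>
         mpoly.span (spinF q n a b ` partitions n) = Sym n"
proof -
  interpret q_in_unit_disc q
    using assms(1) by unfold_locales
  \<comment> \<open>The truncation makes the bounds hold at all indices; entries beyond the first \<open>n\<close> do not enter \<open>spinF\<close>.\<close>
  define a' b' where "a' i = (if i < n then a i else 0)" and "b' i = (if i < n then b i else 0)" for i
  have eq: "spinF q n a b = spinF q n a' b'"
    by (rule ext, rule spinF_cong) (simp_all add: a'_def b'_def)
  have "norm (a' i * b' j) < 1" for i j
  proof -
    have "norm (a' i) < 1" "norm (b' j) < 1"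
      using assms(2,3) by (auto simp: a'_def b'_def)
    then show ?thesis
      unfolding norm_mult using mult_strict_mono[of "norm (a' i)" 1 "norm (b' j)" 1] by simp
  qed
  then show ?thesis
    unfolding eq using spinF_basis[of a' b' n] by blast
qed

end
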